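(* Let $R$ be a ring whose additive group $R^+$ is a free abelian group, and let $\lambda$ be a cardinal with $|R| < \lambda \le 2^{\aleph_0}$. Then there exists an $\aleph_1$-free abelian group $G$ of cardinality $\lambda$ with $\operatorname{End} G = R$. That is, $G$ carries an $R$-module structure such that the map sending $r \in R$ to the scalar multiplication $r \cdot \mathrm{id}_G$ is a ring isomorphism from $R$ onto the endomorphism ring $\operatorname{End} G$ of the abelian group $G$.
   Context: Rings are associative with $1 \neq 0$, not necessarily commutative. Modules are unital right $R$-modules, and endomorphisms of abelian groups are written on the right of their arguments, so $g(\varphi\psi) = (g\varphi)\psi$. Accordingly, for an $R$-module $G$, an element $r\in R$ is identified with the group endomorphism $g \mapsto gr$. $R^+$ denotes the additive group of $R$. An abelian group is $\aleph_1$-free if all its countable subgroups are free abelian. We work in ZFC. *)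

theory Defs
  imports "HOL-Algebra.Free_Abelian_Groups" "HOL-Algebra.QuotRing" "HOL-Library.Countable_Set"
begin

unbundle cardinal_syntax

text \<open>
  Abelian groups are written multiplicatively, as commutative groups of HOL-Algebra. A basis of a
  free abelian group embeds into its carrier, so index sets from the carrier type suffice;
  the lemma \<open>is_free_abelianI\<close> below confirms this.
\<close>

definition is_free_abelian :: "('g, 'm) monoid_scheme \<Rightarrow> bool" where
  "is_free_abelian G \<longleftrightarrow> (\<exists>S :: 'g set. G \<cong> free_Abelian_group S)"

lemma is_free_abelianI:
  fixes G :: "('g, 'm) monoid_scheme" and S :: "'b set"
  assumes G: "G \<cong> free_Abelian_group S"
  shows "is_free_abelian G"
proof -
  obtain h where h: "h \<in> iso G (free_Abelian_group S)"
    using G unfolding is_iso_def by blast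
  then have bij: "bij_betw h (carrier G) (carrier (free_Abelian_group S))"
    by (simp add: iso_def)
  define k where "k = (\<lambda>s. inv_into (carrier G) h (frag_of s))"
  have "h (k s) = frag_of s" if "s \<in> S" for s
    unfolding k_def
    by (rule f_inv_into_f) (use bij that in \<open>auto simp: bij_betw_def\<close>)
  then have "inj_on k S"
    by (intro inj_onI) (metis frag_of_eq)
  then have "S \<approx> k ` S"
    by (meson bij_betw_imageI eqpoll_def)
  then have "free_Abelian_group S \<cong> free_Abelian_group (k ` S)"
    by (simp add: isomorphic_free_Abelian_groups)
  with G show ?thesis
    unfolding is_free_abelian_def by (meson iso_trans)
qed

definition aleph1_free :: "('g, 'm) monoid_scheme \<Rightarrow> bool" where
  "aleph1_free G \<longleftrightarrow> comm_group G \<and>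
     (\<forall>H. subgroup H G \<and> countable H \<longrightarrow> is_free_abelian (G\<lparr>carrier := H\<rparr>))"

text \<open>
  Endomorphisms are represented by functions that are \<open>undefined\<close> outside the carrier, so that two
  endomorphisms are equal iff they agree on the carrier. They act on the right: in the
  product \<open>\<phi> \<psi>\<close> the factor \<open>\<phi>\<close> is applied first.
\<close>

definition End_ring :: "('g, 'm) monoid_scheme \<Rightarrow> ('g \<Rightarrow> 'g) ring" where
  "End_ring G = \<lparr>carrier = hom G G \<inter> extensional (carrier G),
     monoid.mult = (\<lambda>\<phi> \<psi>. compose (carrier G) \<psi> \<phi>),
     one = (\<lambda>g\<in>carrier G. g),
     zero = (\<lambda>g\<in>carrier G. \<one>\<^bsub>G\<^esub>),
     add = (\<lambda>\<phi> \<psi>. \<lambda>g\<in>carrier G. \<phi> g \<otimes>\<^bsub>G\<^esub> \<psi> g)\<rparr>"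

lemma ring_End_ring:
  fixes G (structure)
  assumes "comm_group G"
  shows "ring (End_ring G)"
proof -
  interpret comm_group G by fact
  have cl: "\<phi> g \<in> carrier G" if "\<phi> \<in> hom G G" "g \<in> carrier G" for \<phi> g
    using that by (auto simp: hom_def)
  have ml: "\<phi> (g \<otimes> g') = \<phi> g \<otimes> \<phi> g'"
    if "\<phi> \<in> hom G G" "g \<in> carrier G" "g' \<in> carrier G" for \<phi> g g'
    using that by (auto simp: hom_def)
  have neg: "\<exists>\<psi>\<in>hom G G \<inter> extensional (carrier G).
      (\<lambda>g\<in>carrier G. \<psi> g \<otimes> \<phi> g) = (\<lambda>g\<in>carrier G. \<one>)"
    if "\<phi> \<in> hom G G" for \<phi>
    by (rule bexI[of _ "\<lambda>g\<in>carrier G. inv (\<phi> g)"])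
       (use that in \<open>auto simp: hom_def Pi_iff inv_mult intro!: restrict_ext\<close>)
  show ?thesis
  proof (intro ringI abelian_groupI monoidI)
    fix \<phi> assume "\<phi> \<in> carrier (End_ring G)"
    then show "\<exists>\<psi>\<in>carrier (End_ring G). \<psi> \<oplus>\<^bsub>End_ring G\<^esub> \<phi> = \<zero>\<^bsub>End_ring G\<^esub>"
      using neg by (simp add: End_ring_def)
  qed (auto simp: End_ring_def hom_def Pi_iff compose_def m_ac
         intro!: restrict_ext extensionalityI[where A = "carrier G"])
qed

text \<open>
  The locale \<open>module\<close> of HOL-Algebra only covers modules over commutative rings; \<open>act g r\<close> is the
  product \<open>g r\<close>.
\<close>

locale right_module = R?: ring R + G?: comm_group G
  for R :: "('r, 'n) ring_scheme" (structure) and G :: "('g, 'm) monoid_scheme" (structure)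
    and act :: "'g \<Rightarrow> 'r \<Rightarrow> 'g" +
  assumes act_closed: "\<lbrakk>g \<in> carrier G; r \<in> carrier R\<rbrakk> \<Longrightarrow> act g r \<in> carrier G"
    and act_group_distr: "\<lbrakk>g \<in> carrier G; h \<in> carrier G; r \<in> carrier R\<rbrakk>
      \<Longrightarrow> act (g \<otimes>\<^bsub>G\<^esub> h) r = act g r \<otimes>\<^bsub>G\<^esub> act h r"
    and act_ring_distr: "\<lbrakk>g \<in> carrier G; r \<in> carrier R; s \<in> carrier R\<rbrakk>
      \<Longrightarrow> act g (r \<oplus>\<^bsub>R\<^esub> s) = act g r \<otimes>\<^bsub>G\<^esub> act g s"
    and act_assoc: "\<lbrakk>g \<in> carrier G; r \<in> carrier R; s \<in> carrier R\<rbrakk>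
      \<Longrightarrow> act g (r \<otimes>\<^bsub>R\<^esub> s) = act (act g r) s"
    and act_one: "g \<in> carrier G \<Longrightarrow> act g \<one>\<^bsub>R\<^esub> = g"

end

theory Submission
  imports Defs "HOL-Analysis.Product_Vector"
begin

text \<open>
  Let \<open>A\<close> be the ring, realised on integer vectors. Over the free module \<open>B\<close> on the nodes of the binary
  tree, each branch \<open>y\<close> of a suitable set \<open>Y\<close> carries a label \<open>b = lab y\<close> in \<open>B\<close>, and the
  group is obtained by adjoining to \<open>B\<close> the element \<open>g y = \<Sum>i. i! (y|i + y(i) b)\<close> of the completion of \<open>B\<close>
  in the \<open>\<int>\<close>-adic topology, together with the quotients of its tails by \<open>m!\<close>. Given countably many
  branches, one can cut off initial segments such that the remaining nodes of these branches are
  distinct and do not occur in the earlier labels; then these nodes can be exchanged for the tails,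
  so countable subgroups are free.

  Let \<open>\<phi>\<close> be an endomorphism and \<open>b\<close> in \<open>B\<close>. There are more than \<open>|A|\<close> branches with label \<open>b\<close>, so
  infinitely many of the images \<open>\<phi> (g y)\<close> have the same coefficients. If two such branches \<open>y\<close>, \<open>y'\<close> split
  exactly at \<open>m\<close>, then \<open>g y - g y'\<close> is \<open>m! b\<close> modulo \<open>(m + 1)!\<close>. The branches occurring in the two
  images must then agree below \<open>m\<close>, and since branches with different labels almost never split at
  the same level, only branches with label \<open>b\<close> contribute at \<open>m\<close>. Hence a fixed multiple of
  \<open>\<phi> b\<close> is congruent to an element of \<open>b A\<close> modulo infinitely many integers, and so lies in \<open>b A\<close>.
  Applied to elements \<open>x + x' s\<close> with nodes \<open>x \<noteq> x'\<close>, this shows that \<open>\<phi>\<close> is a scalar.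
\<close>

section \<open>Finitely supported functions as a real vector space\<close>

hide_const (open) Poly_Mapping.range

abbreviation (input) lk :: "('k \<Rightarrow>\<^sub>0 'v::zero) \<Rightarrow> 'k \<Rightarrow> 'v" where "lk \<equiv> Poly_Mapping.lookup"
abbreviation (input) sg :: "'k \<Rightarrow> 'v::zero \<Rightarrow> 'k \<Rightarrow>\<^sub>0 'v" where "sg \<equiv> Poly_Mapping.single"
abbreviation (input) ky :: "('k \<Rightarrow>\<^sub>0 'v::zero) \<Rightarrow> 'k set" where "ky \<equiv> Poly_Mapping.keys"

lemma lookup_map_zero:
  assumes "f 0 = 0"
  shows "lk (Poly_Mapping.map f p) k = f (lk p k)"
  using assms by (simp add: Poly_Mapping.map.rep_eq when_def)

text \<open>Real scalars let quotients by factorials live in one vector space, where integrality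
  becomes a condition on coefficients.\<close>

instantiation poly_mapping :: (type, real_vector) real_vector
begin

definition scaleR_poly_mapping :: "real \<Rightarrow> ('a \<Rightarrow>\<^sub>0 'b) \<Rightarrow> 'a \<Rightarrow>\<^sub>0 'b" where
  "scaleR_poly_mapping c = Poly_Mapping.map (scaleR c)"

instance
  by standard
    (simp_all add: scaleR_poly_mapping_def poly_mapping_eq_iff fun_eq_iff lookup_map_zero lookup_add
      scaleR_add_left scaleR_add_right)

end

lemma lookup_scaleR [simp]: "lk (c *\<^sub>R p) k = c *\<^sub>R lk p k"
  by (simp add: scaleR_poly_mapping_def lookup_map_zero)

lemma keys_scaleR: "c \<noteq> 0 \<Longrightarrow> ky (c *\<^sub>R p) = ky p"
  by (auto simp: in_keys_iff)

lemma scaleR_single: "c *\<^sub>R sg k a = sg k (c *\<^sub>R a)"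
  by (rule poly_mapping_eqI) (simp add: lookup_single when_def)

lemma pm_sum_single: "p = (\<Sum>k\<in>ky p. sg k (lk p k))"
  by (rule poly_mapping_eqI) (simp add: lookup_sum lookup_single when_def in_keys_iff)

text \<open>The linear map out of a direct sum with prescribed linear restrictions
  \<open>F k\<close> to the summands.\<close>

definition lin_extend :: "('k \<Rightarrow> 'v::real_vector \<Rightarrow> 'w::real_vector) \<Rightarrow> ('k \<Rightarrow>\<^sub>0 'v) \<Rightarrow> 'w" where
  "lin_extend F p = (\<Sum>k\<in>ky p. F k (lk p k))"

lemma lin_extend_superset:
  assumes "\<And>k. linear (F k)" "finite K" "ky p \<subseteq> K"
  shows "lin_extend F p = (\<Sum>k\<in>K. F k (lk p k))"
  unfolding lin_extend_def using assms
  by (intro sum.mono_neutral_left) (auto simp: in_keys_iff linear_0)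

lemma linear_lin_extend:
  assumes "\<And>k. linear (F k)"
  shows "linear (lin_extend F)"
proof (rule linearI)
  fix p q :: "'a \<Rightarrow>\<^sub>0 'b" and c :: real
  let ?K = "ky p \<union> ky q"
  have "lin_extend F (p + q) = (\<Sum>k\<in>?K. F k (lk (p + q) k))"
    by (rule lin_extend_superset[OF assms]) (use Poly_Mapping.keys_add[of p q] in auto)
  also have "\<dots> = (\<Sum>k\<in>?K. F k (lk p k)) + (\<Sum>k\<in>?K. F k (lk q k))"
    by (simp add: lookup_add linear_add[OF assms] sum.distrib)
  finally show "lin_extend F (p + q) = lin_extend F p + lin_extend F q"
    using lin_extend_superset[OF assms, where K = ?K] by auto
  have "lin_extend F (c *\<^sub>R p) = (\<Sum>k\<in>ky p. F k (lk (c *\<^sub>R p) k))"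
    by (rule lin_extend_superset[OF assms]) (auto simp: in_keys_iff)
  then show "lin_extend F (c *\<^sub>R p) = c *\<^sub>R lin_extend F p"
    by (simp add: lin_extend_def linear_scale[OF assms] scaleR_sum_right)
qed

lemma lin_extend_single:
  assumes "linear (F k)"
  shows "lin_extend F (sg k a) = F k a"
  using assms by (simp add: lin_extend_def linear_0)

lemma linear_eq_on_singles:
  assumes f: "linear f" and g: "linear g"
    and eq: "\<And>k. k \<in> ky p \<Longrightarrow> f (sg k (lk p k)) = g (sg k (lk p k))"
  shows "f p = g p"
proof -
  have "f p = (\<Sum>k\<in>ky p. f (sg k (lk p k)))"
    by (subst pm_sum_single) (simp add: linear_sum[OF f])
  also have "\<dots> = (\<Sum>k\<in>ky p. g (sg k (lk p k)))"
    by (simp add: eq)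
  also have "\<dots> = g p"
    by (subst (3) pm_sum_single) (simp add: linear_sum[OF g])
  finally show ?thesis .
qed

section \<open>Subgroups of free abelian groups\<close>

lemma finite_total_order_max:
  assumes "total_on A r" "refl_on B r" "trans r" "A \<subseteq> B" "finite A" "A \<noteq> {}"
  shows "\<exists>m\<in>A. \<forall>a\<in>A. (a, m) \<in> r"
  using assms(5,6,1,4)
proof (induction A rule: finite_ne_induct)
  case (singleton x)
  then show ?case using assms(2) by (auto simp: refl_on_def)
next
  case (insert x F)
  then obtain m where m: "m \<in> F" "\<forall>a\<in>F. (a, m) \<in> r"
    by (auto simp: total_on_def)
  from insert m have "(x, m) \<in> r \<or> (m, x) \<in> r"
    by (auto simp: total_on_def)
  then show ?case
    using m insert.prems assms(2,3) by (auto simp: refl_on_def intro: transD)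
qed

text \<open>
  A basis consists, for each \<open>s\<close>, of an element with largest key \<open>s\<close> (in a well-order of the
  basis of the ambient group) whose coefficient at \<open>s\<close> is minimal.
\<close>

lemma subgroup_of_free_basis:
  fixes H :: "('s \<Rightarrow>\<^sub>0 int) set"
  assumes H0: "0 \<in> H" and Hdiff: "\<And>f g. f \<in> H \<Longrightarrow> g \<in> H \<Longrightarrow> f - g \<in> H"
  shows "\<exists>(I :: 's set) b. (\<forall>s\<in>I. b s \<in> H) \<and> (\<forall>f\<in>H. \<exists>c. ky c \<subseteq> I \<and> f = frag_extend b c) \<and>
    (\<forall>c. ky c \<subseteq> I \<longrightarrow> frag_extend b c = 0 \<longrightarrow> c = 0)"
proof -
  have Hmul: "frag_cmul k f \<in> H" if "f \<in> H" for f k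
  proof -
    have neg: "- g \<in> H" if "g \<in> H" for g
      using Hdiff[OF H0 that] by simp
    have "frag_cmul (int n) f \<in> H" for n
    proof (induction n)
      case (Suc n)
      have "frag_cmul (int (Suc n)) f = frag_cmul (int n) f - (- f)"
        by (simp add: frag_cmul_distrib)
      then show ?case using Hdiff[OF Suc neg[OF \<open>f \<in> H\<close>]] by simp
    qed (simp add: H0)
    then show ?thesis
      using neg by (cases k rule: int_cases2) (auto simp flip: minus_frag_cmul)
  qed
  obtain r :: "'s rel" where r: "well_order_on UNIV r"
    using well_order_on by blast
  then have tot: "total_on UNIV r" and rfl: "refl_on UNIV r" and trn: "trans r"
    and anti: "antisym r" and wf: "wf (r - Id)"
    by (auto simp: well_order_on_def linear_order_on_def partial_order_on_def preorder_on_def)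
  have max: "\<exists>m\<in>ky c. \<forall>a\<in>ky c. (a, m) \<in> r" if "c \<noteq> 0" for c :: "'s \<Rightarrow>\<^sub>0 int"
    by (rule finite_total_order_max[OF _ rfl trn]) (use tot that in \<open>auto simp: total_on_def\<close>)
  define below where "below s = {f \<in> H. \<forall>t\<in>ky f. (t, s) \<in> r}" for s
  have belowH: "f \<in> H" if "f \<in> below s" for f s using that by (simp add: below_def)
  have below_diff: "f - frag_cmul k g \<in> below s" if "f \<in> below s" "g \<in> below s" for f g k s
  proof -
    have "ky (f - frag_cmul k g) \<subseteq> ky f \<union> ky g"
      using keys_diff[of f "frag_cmul k g"] keys_cmul[of k g] by auto
    then show ?thesis using that by (auto simp: below_def Hdiff Hmul)
  qed
  define I where "I = {s. \<exists>f\<in>below s. lk f s \<noteq> 0}"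
  have "\<exists>b. b \<in> below s \<and> lk b s \<noteq> 0 \<and> (\<forall>f\<in>below s. lk b s dvd lk f s)" if s: "s \<in> I" for s
  proof -
    let ?P = "\<lambda>n. \<exists>f\<in>below s. nat \<bar>lk f s\<bar> = n \<and> n \<noteq> 0"
    have ex: "\<exists>n. ?P n" using s by (auto simp: I_def)
    obtain b where b: "b \<in> below s" "nat \<bar>lk b s\<bar> = (LEAST n. ?P n)" "(LEAST n. ?P n) \<noteq> 0"
      using LeastI_ex[OF ex] by auto
    have "lk b s dvd lk f s" if f: "f \<in> below s" for f
    proof (rule ccontr)
      assume nd: "\<not> lk b s dvd lk f s"
      \<comment> \<open>Division with remainder: the multiple of \<open>b\<close> is chosen so that
        the coefficient at \<open>s\<close> becomes the remainder, a nonzero value smaller than the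
        minimum.\<close>
      let ?f = "f - frag_cmul (lk f s div lk b s) b"
      have e: "lk ?f s = lk f s mod lk b s"
        by (simp add: lookup_minus minus_div_mult_eq_mod)
      then have "?P (nat \<bar>lk f s mod lk b s\<bar>)"
        using below_diff[OF f b(1)] nd by (intro bexI[of _ ?f]) (auto simp: dvd_eq_mod_eq_0)
      then have "(LEAST n. ?P n) \<le> nat \<bar>lk f s mod lk b s\<bar>"
        by (rule Least_le)
      moreover have "\<bar>lk f s mod lk b s\<bar> < \<bar>lk b s\<bar>"
        using b by (intro abs_mod_less) auto
      ultimately show False using b(2) by linarith
    qed
    then show ?thesis using b by (intro exI[of _ b]) auto
  qed
  then obtain b where b: "\<And>s. s \<in> I \<Longrightarrow> b s \<in> below s" "\<And>s. s \<in> I \<Longrightarrow> lk (b s) s \<noteq> 0"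
    "\<And>s f. s \<in> I \<Longrightarrow> f \<in> below s \<Longrightarrow> lk (b s) s dvd lk f s"
    by metis
  have span: "\<exists>c. ky c \<subseteq> I \<and> f = frag_extend b c" if "f \<in> below s" for f s
    using wf that
  proof (induction s arbitrary: f rule: wf_induct_rule)
    case (less s)
    have zero: "\<exists>c. ky c \<subseteq> I \<and> g = frag_extend b c" if g: "g \<in> below s" "lk g s = 0" for g
    proof (cases "g = 0")
      case True
      then show ?thesis by (intro exI[of _ 0]) simp
    next
      case False
      \<comment> \<open>Since the coefficient at \<open>s\<close> vanishes, the largest key is
        strictly below \<open>s\<close>, and the induction hypothesis applies.\<close>
      then obtain m where m: "m \<in> ky g" "\<forall>a\<in>ky g. (a, m) \<in> r"
        using max by blast
      with g have "(m, s) \<in> r - Id" "g \<in> below m"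
        by (auto simp: below_def in_keys_iff)
      then show ?thesis by (rule less.IH)
    qed
    show ?case
    proof (cases "lk f s = 0")
      case True
      then show ?thesis using zero less.prems by blast
    next
      case False
      then have s: "s \<in> I" using less.prems by (auto simp: I_def)
      then obtain k where k: "lk f s = lk (b s) s * k"
        using b(3) less.prems by blast
      have "\<exists>c. ky c \<subseteq> I \<and> f - frag_cmul k (b s) = frag_extend b c"
        by (rule zero) (use below_diff b(1) s less.prems k in \<open>auto simp: lookup_minus\<close>)
      then obtain c where c: "ky c \<subseteq> I" "f - frag_cmul k (b s) = frag_extend b c" by blast
      have "f = frag_extend b (c + frag_cmul k (frag_of s))"
        using c(2) by (simp add: frag_extend_add frag_extend_cmul algebra_simps)
      moreover have "ky (c + frag_cmul k (frag_of s)) \<subseteq> I"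
        using c(1) s Poly_Mapping.keys_add[of c "frag_cmul k (frag_of s)"]
          keys_cmul[of k "frag_of s"] by (auto simp: keys_frag_of)
      ultimately show ?thesis by blast
    qed
  qed
  show ?thesis
  proof (intro exI[of _ I] exI[of _ b] conjI ballI allI impI)
    show "b s \<in> H" if "s \<in> I" for s using b(1) belowH that by blast
    show "\<exists>c. ky c \<subseteq> I \<and> f = frag_extend b c" if f: "f \<in> H" for f
    proof (cases "f = 0")
      case True
      then show ?thesis by (intro exI[of _ 0]) simp
    next
      case False
      then obtain m where "m \<in> ky f" "\<forall>a\<in>ky f. (a, m) \<in> r"
        using max by blast
      then have "f \<in> below m" using f by (auto simp: below_def)
      then show ?thesis by (rule span)
    qed
    show "c = 0" if c: "ky c \<subseteq> I" "frag_extend b c = 0" for c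
    proof (rule ccontr)
      assume "c \<noteq> 0"
      then obtain m where m: "m \<in> ky c" "\<forall>a\<in>ky c. (a, m) \<in> r"
        using max by blast
      \<comment> \<open>Triangularity: at the largest key \<open>m\<close> of \<open>c\<close> only
        \<open>b m\<close> contributes, because the keys of \<open>b t\<close> are at most
        \<open>t\<close>.\<close>
      have "lk (b t) m = 0" if "t \<in> ky c - {m}" for t
      proof -
        have "(m, t) \<notin> r" using m that anti by (auto dest: antisymD)
        moreover have "b t \<in> below t" using b(1) that c(1) by blast
        ultimately show ?thesis by (auto simp: below_def in_keys_iff)
      qed
      then have "(\<Sum>t\<in>ky c. lk c t * lk (b t) m) = lk c m * lk (b m) m"
        using m(1) by (subst sum.remove[of _ m]) auto
      moreover have "lk (frag_extend b c) m = (\<Sum>t\<in>ky c. lk c t * lk (b t) m)"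
        by (simp add: frag_extend_def lookup_sum)
      moreover have "lk c m \<noteq> 0" "lk (b m) m \<noteq> 0"
        using m(1) b(2) c(1) by (auto simp: in_keys_iff)
      ultimately show False using c(2) by simp
    qed
  qed
qed

text \<open>The image of \<open>h\<close> has a basis by \<open>subgroup_of_free_basis\<close>,
  which is carried back along the inverse of \<open>h\<close>. Its index set has type
  \<open>'s\<close>; \<open>is_free_abelianI\<close> moves it to the carrier type.\<close>

lemma is_free_abelian_embed:
  fixes G :: "('g, 'm) monoid_scheme" and S :: "'s set"
  assumes G: "group G" and h: "h \<in> hom G (free_Abelian_group S)" and inj: "inj_on h (carrier G)"
  shows "is_free_abelian G"
proof -
  have gh: "group_hom G (free_Abelian_group S) h"
    using G h by (simp add: group_hom_def group_hom_axioms_def)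
  note hmult = group_hom.hom_mult[OF gh] and hinv = group_hom.hom_inv[OF gh]
  let ?H = "h ` carrier G"
  have cl: "ky (h g) \<subseteq> S" if "g \<in> carrier G" for g
    using group_hom.hom_closed[OF gh that] by simp
  have "h \<one>\<^bsub>G\<^esub> = 0"
    using group_hom.hom_one[OF gh] by simp
  moreover have one: "\<one>\<^bsub>G\<^esub> \<in> carrier G"
    using G by (simp add: group.is_monoid monoid.one_closed)
  ultimately have H0: "0 \<in> ?H" by (metis imageI)
  have mult: "x \<otimes>\<^bsub>G\<^esub> y \<in> carrier G" if "x \<in> carrier G" "y \<in> carrier G" for x y
    using G that by (simp add: group.is_monoid monoid.m_closed)
  have Hdiff: "f - g \<in> ?H" if fg: "f \<in> ?H" "g \<in> ?H" for f g
  proof -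
    obtain x y where xy: "x \<in> carrier G" "f = h x" "y \<in> carrier G" "g = h y"
      using fg by blast
    have iy: "inv\<^bsub>G\<^esub> y \<in> carrier G"
      using G xy by (simp add: group.inv_closed)
    have "h (x \<otimes>\<^bsub>G\<^esub> inv\<^bsub>G\<^esub> y) = h x + - h y"
      using hmult[OF xy(1) iy] hinv[OF xy(3)] cl[OF xy(3)] by simp
    then have "f - g = h (x \<otimes>\<^bsub>G\<^esub> inv\<^bsub>G\<^esub> y)"
      using xy by simp
    then show ?thesis
      using mult[OF xy(1) iy] by (rule image_eqI)
  qed
  have "\<exists>(I :: 's set) b. (\<forall>s\<in>I. b s \<in> ?H) \<and> (\<forall>f\<in>?H. \<exists>c. ky c \<subseteq> I \<and> f = frag_extend b c) \<and>
    (\<forall>c. ky c \<subseteq> I \<longrightarrow> frag_extend b c = 0 \<longrightarrow> c = 0)"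
    by (rule subgroup_of_free_basis) (fact H0 Hdiff)+
  then obtain I :: "'s set" and b where b: "\<forall>s\<in>I. b s \<in> ?H"
    "\<forall>f\<in>?H. \<exists>c. ky c \<subseteq> I \<and> f = frag_extend b c"
    "\<forall>c. ky c \<subseteq> I \<longrightarrow> frag_extend b c = 0 \<longrightarrow> c = 0"
    by (elim exE conjE) (rule that)
  have inH: "frag_extend b c \<in> ?H" if "ky c \<subseteq> I" for c
    using that
  proof (induction c rule: frag_induction)
    case zero show ?case using H0 by simp
  next
    case (one x) then show ?case using b(1) by simp
  next
    case (diff x y) then show ?case using Hdiff by (simp add: frag_extend_diff)
  qed
  have bij: "bij_betw (frag_extend b) (carrier (free_Abelian_group I)) ?H"
  proof (rule bij_betw_imageI)
    show "inj_on (frag_extend b) (carrier (free_Abelian_group I))"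
    proof (rule inj_onI)
      fix c d assume cd: "c \<in> carrier (free_Abelian_group I)" "d \<in> carrier (free_Abelian_group I)"
        and eq: "frag_extend b c = frag_extend b d"
      have "ky (c - d) \<subseteq> I"
        using keys_diff[of c d] cd by auto
      moreover have "frag_extend b (c - d) = 0"
        using eq by (simp add: frag_extend_diff)
      ultimately have "c - d = 0"
        using b(3) by blast
      then show "c = d" by simp
    qed
    show "frag_extend b ` carrier (free_Abelian_group I) = ?H"
    proof
      show "frag_extend b ` carrier (free_Abelian_group I) \<subseteq> ?H"
        using inH by (intro image_subsetI) simp
      show "?H \<subseteq> frag_extend b ` carrier (free_Abelian_group I)"
      proof
        fix f assume "f \<in> ?H"
        then obtain c where "ky c \<subseteq> I" "f = frag_extend b c" using b(2) by blast
        then show "f \<in> frag_extend b ` carrier (free_Abelian_group I)"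
          by (intro image_eqI[of _ _ c]) simp_all
      qed
    qed
  qed
  define k where "k = inv_into (carrier G) h \<circ> frag_extend b"
  have hbij: "bij_betw h (carrier G) ?H" using inj by (rule inj_on_imp_bij_betw)
  have kbij: "bij_betw k (carrier (free_Abelian_group I)) (carrier G)"
    unfolding k_def by (rule bij_betw_trans[OF bij bij_betw_inv_into[OF hbij]])
  have hk: "h (k c) = frag_extend b c" if "ky c \<subseteq> I" for c
    unfolding k_def using inH[OF that] by (simp add: f_inv_into_f)
  have kc: "k c \<in> carrier G" if "ky c \<subseteq> I" for c
    using kbij that by (auto simp: bij_betw_def)
  have "k (c + d) = k c \<otimes>\<^bsub>G\<^esub> k d" if "ky c \<subseteq> I" "ky d \<subseteq> I" for c d
  proof (rule inj_onD[OF inj])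
    have cd: "ky (c + d) \<subseteq> I" using that Poly_Mapping.keys_add[of c d] by auto
    show "h (k (c + d)) = h (k c \<otimes>\<^bsub>G\<^esub> k d)"
      using that cd by (simp add: hk kc hmult frag_extend_add)
    show "k (c + d) \<in> carrier G" "k c \<otimes>\<^bsub>G\<^esub> k d \<in> carrier G"
      using that cd by (simp_all add: kc mult)
  qed
  then have "k \<in> iso (free_Abelian_group I) G"
    using kbij by (auto simp: iso_def hom_def kc)
  then have "free_Abelian_group I \<cong> G" by (auto simp: is_iso_def)
  then have "G \<cong> free_Abelian_group I"
    using group.iso_sym group_free_Abelian_group by blast
  then show ?thesis by (rule is_free_abelianI)
qed

section \<open>Labelled branches\<close>

text \<open>
  The branch with label \<open>b\<close> and parameter \<open>u\<close> is the set of codes of the finite initial segments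
  of the pair \<open>(\<eta> b, u)\<close>; for distinct labels only finitely many codes can agree. Codes are doubled
  because the levels at which branches split must not be consecutive.
\<close>

lemma labelled_branches:
  fixes B :: "'b set" and U :: "(nat \<Rightarrow> bool) set"
  assumes "|B| \<le>o |UNIV :: (nat \<Rightarrow> bool) set|"
  shows "\<exists>(Y :: (nat \<Rightarrow> bool) set) lab. (\<forall>y\<in>Y. lab y \<in> B \<and> (\<forall>i. y i \<longrightarrow> even i)) \<and>
    (\<forall>b\<in>B. |U| \<le>o |{y \<in> Y. lab y = b}| ) \<and> |Y| \<le>o |B \<times> U| \<and>
    (\<forall>b\<in>B. \<forall>b'\<in>B. b \<noteq> b' \<longrightarrow>
      (\<exists>M. \<forall>m\<ge>M. \<forall>y\<in>Y. \<forall>y'\<in>Y. lab y = b \<longrightarrow> lab y' = b' \<longrightarrow> \<not> (y m \<and> y' m)))"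
proof -
  obtain \<eta> :: "'b \<Rightarrow> nat \<Rightarrow> bool" where \<eta>: "inj_on \<eta> B"
    using assms card_of_ordLeq[of B "UNIV :: (nat \<Rightarrow> bool) set"] by blast
  define seg where "seg p k = map (\<lambda>j. (\<eta> (fst p) j, snd p j)) [0..<k]" for p :: "'b \<times> (nat \<Rightarrow> bool)" and k
  define br where "br p = (\<lambda>i. \<exists>k. i = 2 * to_nat (seg p k))" for p
  have seg_eq: "\<eta> (fst p) j = \<eta> (fst p') j \<and> snd p j = snd p' j"
    if "seg p k = seg p' k'" "j < k" for p p' j k k'
  proof -
    from that(1) have "k = k'" by (metis diff_zero length_map length_upt seg_def)
    then have "seg p k ! j = seg p' k ! j" using that(1) by simp
    then show ?thesis using that(2) by (simp add: seg_def)
  qed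
  have inj: "inj_on br (B \<times> UNIV)"
  proof (rule inj_onI)
    fix p p' assume p: "p \<in> B \<times> UNIV" "p' \<in> B \<times> UNIV" and eq: "br p = br p'"
    have "\<eta> (fst p) j = \<eta> (fst p') j \<and> snd p j = snd p' j" for j
    proof -
      have "br p (2 * to_nat (seg p (Suc j)))" by (auto simp: br_def)
      then obtain k' where "seg p (Suc j) = seg p' k'"
        unfolding eq by (auto simp: br_def)
      then show ?thesis by (rule seg_eq) simp
    qed
    then have e: "\<eta> (fst p) = \<eta> (fst p')" and s: "snd p = snd p'" by auto
    have "fst p = fst p'"
      by (rule inj_onD[OF \<eta> e]) (use p in \<open>auto simp: mem_Times_iff\<close>)
    then show "p = p'"
      using s by (rule prod_eqI)
  qed
  define Y where "Y = br ` (B \<times> U)"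
  define lab where "lab y = fst (inv_into (B \<times> UNIV) br y)" for y
  have lab: "lab (br (b, u)) = b" if "b \<in> B" for b u
    using that inj by (simp add: lab_def inv_into_f_f)
  show ?thesis
  proof (intro exI[of _ Y] exI[of _ lab] conjI ballI allI impI)
    show "lab y \<in> B" if "y \<in> Y" for y using that lab by (auto simp: Y_def)
    show "even i" if "y \<in> Y" "y i" for y i using that by (auto simp: Y_def br_def)
    show "|U| \<le>o |{y \<in> Y. lab y = b}|" if b: "b \<in> B" for b
    proof -
      have "inj_on (\<lambda>u. br (b, u)) U"
      proof (rule inj_onI)
        fix u u' assume "br (b, u) = br (b, u')"
        then have "(b, u) = (b, u')"
          by (rule inj_onD[OF inj]) (use b in auto)
        then show "u = u'" by simp
      qed
      then show ?thesis
        by (rule card_of_ordLeqI) (use b lab in \<open>auto simp: Y_def\<close>)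
    qed
    show "|Y| \<le>o |B \<times> U|" unfolding Y_def by (rule card_of_image)
    show "\<exists>M. \<forall>m\<ge>M. \<forall>y\<in>Y. \<forall>y'\<in>Y. lab y = b \<longrightarrow> lab y' = b' \<longrightarrow> \<not> (y m \<and> y' m)"
      if b: "b \<in> B" "b' \<in> B" "b \<noteq> b'" for b b'
    proof -
      have "\<eta> b \<noteq> \<eta> b'"
        using inj_onD[OF \<eta>, of b b'] b by blast
      then obtain j where j: "\<eta> b j \<noteq> \<eta> b' j" by blast
      \<comment> \<open>Segments longer than \<open>j\<close> record the differing values of
        \<open>\<eta> b\<close> and \<open>\<eta> b'\<close> at \<open>j\<close>, so a common code
        comes from one of the finitely many lists of length at most \<open>j\<close>.\<close>
      let ?C = "(\<lambda>l. 2 * to_nat l) ` {l :: (bool \<times> bool) list. set l \<subseteq> UNIV \<and> length l \<le> j}"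
      have fin: "finite ?C" by (intro finite_imageI finite_lists_length_le finite)
      have "m \<in> ?C" if y: "y \<in> Y" "y' \<in> Y" "lab y = b" "lab y' = b'" "y m" "y' m" for m y y'
      proof -
        obtain u u' where u: "y = br (b, u)" "y' = br (b', u')"
          using y lab by (auto simp: Y_def)
        then have "br (b, u) m" "br (b', u') m" using y by simp_all
        then obtain k k' where k: "m = 2 * to_nat (seg (b, u) k)" "m = 2 * to_nat (seg (b', u') k')"
          unfolding br_def by blast
        then have "seg (b, u) k = seg (b', u') k'" by simp
        from seg_eq[OF this, of j] j have "k \<le> j" by (auto simp flip: not_less)
        then show ?thesis using k by (auto simp: seg_def)
      qed
      then have "\<forall>m\<ge>Suc (Max ?C). \<forall>y\<in>Y. \<forall>y'\<in>Y. lab y = b \<longrightarrow> lab y' = b' \<longrightarrow> \<not> (y m \<and> y' m)"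
        using Max_ge[OF fin] not_less_eq_eq by blast
      then show ?thesis ..
    qed
  qed
qed

section \<open>The module\<close>

text \<open>A predicate on subsets of an additive type, so that the construction can use ordinary
  arithmetic; a group record is formed only when the result is transported.\<close>

definition add_subgroup :: "'v::ab_group_add set \<Rightarrow> bool" where
  "add_subgroup S \<longleftrightarrow> 0 \<in> S \<and> (\<forall>x\<in>S. \<forall>y\<in>S. x - y \<in> S)"

lemma add_subgroup_0: "add_subgroup S \<Longrightarrow> 0 \<in> S"
  and add_subgroup_diff: "add_subgroup S \<Longrightarrow> x \<in> S \<Longrightarrow> y \<in> S \<Longrightarrow> x - y \<in> S"
  by (auto simp: add_subgroup_def)

lemma add_subgroup_minus:
  assumes "add_subgroup S" "x \<in> S"
  shows "- x \<in> S"
  using add_subgroup_diff[OF assms(1) add_subgroup_0[OF assms(1)] assms(2)] by simp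

lemma add_subgroup_add:
  assumes "add_subgroup S" "x \<in> S" "y \<in> S"
  shows "x + y \<in> S"
  using add_subgroup_diff[OF assms(1,2) add_subgroup_minus[OF assms(1,3)]] by simp

lemma add_subgroup_sum:
  assumes "add_subgroup S" "\<And>i. i \<in> I \<Longrightarrow> f i \<in> S"
  shows "sum f I \<in> S"
  using assms(2) by (induction I rule: infinite_finite_induct)
    (auto intro: add_subgroup_0[OF assms(1)] add_subgroup_add[OF assms(1)])

lemma add_subgroup_scale:
  fixes S :: "'v::real_vector set"
  assumes S: "add_subgroup S" and x: "x \<in> S" and c: "c \<in> \<int>"
  shows "c *\<^sub>R x \<in> S"
proof -
  have nat: "real n *\<^sub>R x \<in> S" for n
    by (induction n) (auto simp: scaleR_add_left x intro: add_subgroup_0[OF S] add_subgroup_add[OF S])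
  obtain k :: int where "c = of_int k" using c by (rule Ints_cases)
  then show ?thesis
    using nat add_subgroup_minus[OF S] by (cases k rule: int_cases2) fastforce+
qed

lemma add_subgroup_image:
  assumes "add_subgroup S" "linear f"
  shows "add_subgroup (f ` S)"
  unfolding add_subgroup_def
proof (intro conjI ballI)
  show "0 \<in> f ` S" using add_subgroup_0[OF assms(1)] linear_0[OF assms(2)] by (metis imageI)
  show "x - y \<in> f ` S" if "x \<in> f ` S" "y \<in> f ` S" for x y
    using that by (auto simp flip: linear_diff[OF assms(2)] intro: imageI add_subgroup_diff[OF assms(1)])
qed

section \<open>Coefficient rings and free modules over them\<close>

type_synonym 's coef = "'s \<Rightarrow>\<^sub>0 real"

text \<open>The ring is a set of integer vectors. Since \<open>mul\<close> is bilinear on the whole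
  real vector space, it commutes with division by factorials. The unit laws are asked on
  \<open>A\<close> alone, because in the intended instance \<open>mul\<close> kills coordinates
  outside the basis of the ring.\<close>

locale coefficient_ring =
  fixes A :: "'s coef set" and mul :: "'s coef \<Rightarrow> 's coef \<Rightarrow> 's coef" and e :: "'s coef"
  assumes A_int: "a \<in> A \<Longrightarrow> lk a s \<in> \<int>"
    and A_sub: "add_subgroup A"
    and A_mul: "a \<in> A \<Longrightarrow> b \<in> A \<Longrightarrow> mul a b \<in> A"
    and linear_mul_left: "linear (\<lambda>a. mul a b)"
    and linear_mul_right: "linear (mul a)"
    and mul_assoc: "mul (mul a b) c = mul a (mul b c)"
    and e_in: "e \<in> A" and e_nonzero: "e \<noteq> 0"
    and mul_e_left: "a \<in> A \<Longrightarrow> mul e a = a" and mul_e_right: "a \<in> A \<Longrightarrow> mul a e = a"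
begin

lemmas A_0 = add_subgroup_0[OF A_sub] and A_diff = add_subgroup_diff[OF A_sub]
  and A_sum = add_subgroup_sum[OF A_sub] and A_scale = add_subgroup_scale[OF A_sub]

lemmas mul_0_left [simp] = linear_0[OF linear_mul_left]
lemmas mul_0_right [simp] = linear_0[OF linear_mul_right]

text \<open>The free module over \<open>A\<close> on the index type \<open>'k\<close>, as a subset
  of the real vector space.\<close>

definition AP :: "('k \<Rightarrow>\<^sub>0 's coef) set" where
  "AP = {p. \<forall>k. lk p k \<in> A}"

lemma AP_sub: "add_subgroup AP"
  by (auto simp: AP_def add_subgroup_def lookup_minus A_0 intro: A_diff)

lemmas AP_0 = add_subgroup_0[OF AP_sub] and AP_diff = add_subgroup_diff[OF AP_sub]
  and AP_add = add_subgroup_add[OF AP_sub]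
  and AP_sum = add_subgroup_sum[OF AP_sub] and AP_scale = add_subgroup_scale[OF AP_sub]

lemma AP_single [simp]: "sg k a \<in> AP \<longleftrightarrow> a \<in> A"
  by (auto simp: AP_def lookup_single when_def A_0 split: if_splits)

lemma AP_lookup: "p \<in> AP \<Longrightarrow> lk p k \<in> A"
  by (simp add: AP_def)

definition rm :: "('k \<Rightarrow>\<^sub>0 's coef) \<Rightarrow> 's coef \<Rightarrow> ('k \<Rightarrow>\<^sub>0 's coef)" where
  "rm p a = Poly_Mapping.map (\<lambda>c. mul c a) p"

lemma lookup_rm [simp]: "lk (rm p a) k = mul (lk p k) a"
  by (simp add: rm_def lookup_map_zero)

lemma linear_rm_left: "linear (\<lambda>p. rm p a)"
  by (rule linearI; rule poly_mapping_eqI)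
    (simp_all add: lookup_add linear_add[OF linear_mul_left] linear_scale[OF linear_mul_left])

lemma linear_rm_right: "linear (rm p)"
  by (rule linearI; rule poly_mapping_eqI)
    (simp_all add: lookup_add linear_add[OF linear_mul_right] linear_scale[OF linear_mul_right])

lemma rm_rm: "rm (rm p a) b = rm p (mul a b)"
  by (rule poly_mapping_eqI) (simp add: mul_assoc)

lemma rm_single: "rm (sg k a) b = sg k (mul a b)"
  by (rule poly_mapping_eqI) (simp add: lookup_single when_def)

lemma rm_AP: "p \<in> AP \<Longrightarrow> a \<in> A \<Longrightarrow> rm p a \<in> AP"
  by (simp add: AP_def A_mul)

lemma keys_rm: "ky (rm p a) \<subseteq> ky p"
  by (auto simp: in_keys_iff)

lemma lin_extend_rm_AP:
  assumes "\<And>k. F k \<in> AP" "p \<in> AP"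
  shows "lin_extend (\<lambda>k. rm (F k)) p \<in> AP"
  unfolding lin_extend_def using assms by (intro AP_sum rm_AP) (auto simp: AP_def)

text \<open>By associativity of \<open>mul\<close>, extensions of this form are
  \<open>A\<close>-linear; this is what makes \<open>theta\<close> compatible with the
  action.\<close>

lemma rm_lin_extend:
  "rm (lin_extend (\<lambda>k. rm (F k)) p) a = lin_extend (\<lambda>k. rm (F k)) (rm p a)"
proof -
  have "rm (lin_extend (\<lambda>k. rm (F k)) p) a = (\<Sum>k\<in>ky p. rm (F k) (lk (rm p a) k))"
    by (simp add: lin_extend_def linear_sum[OF linear_rm_left] rm_rm)
  also have "\<dots> = lin_extend (\<lambda>k. rm (F k)) (rm p a)"
    by (rule lin_extend_superset[symmetric]) (auto simp: linear_rm_right keys_rm)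
  finally show ?thesis .
qed

end

section \<open>The group generated by nodes and tail quotients\<close>

definition node :: "(nat \<Rightarrow> bool) \<Rightarrow> nat \<Rightarrow> bool list" where
  "node y i = map y [0..<i]"

lemma node_eq_iff: "node y i = node y' j \<longleftrightarrow> i = j \<and> (\<forall>k<i. y k = y' k)"
  by (auto simp: node_def list_eq_iff_nth_eq)

lemma length_node [simp]: "length (node y i) = i"
  by (simp add: node_def)

abbreviation q :: "nat \<Rightarrow> real" where "q \<equiv> fact"

lemma q_Suc: "q (Suc m) = real (Suc m) * q m"
  by simp

lemma q_multiple: "m \<le> n \<Longrightarrow> \<exists>k::nat. q n = real k * q m"
  by (metis fact_dvd of_nat_fact of_nat_mult dvdE mult.commute)

type_synonym 's vec = "(bool list \<Rightarrow>\<^sub>0 's coef) \<times> ((nat \<Rightarrow> bool) \<Rightarrow>\<^sub>0 's coef)"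

text \<open>
  The vector space \<open>'s vec\<close> has a basis consisting of the nodes of the binary tree (first component)
  and of one element \<open>g y\<close> for each branch \<open>y\<close> (second component). One thinks of \<open>g y\<close> as the infinite
  sum of \<open>q i *\<^sub>R el y i\<close>, whose partial sums are \<open>t y m\<close>, and of \<open>gg y m a\<close> as the quotient by \<open>q m\<close>
  of the tail of this sum, times \<open>a\<close>. Replacing each \<open>g y\<close> by \<open>t y m\<close> yields \<open>theta m\<close>, which therefore
  detects divisibility by \<open>q m\<close>; \<open>Gn m\<close> is generated by the nodes and the elements \<open>gg y m a\<close>.
\<close>

locale branch_module = coefficient_ring A mul e
  for A :: "'s coef set" and mul e +
  fixes Y :: "(nat \<Rightarrow> bool) set" and lab :: "(nat \<Rightarrow> bool) \<Rightarrow> (bool list \<Rightarrow>\<^sub>0 's coef)"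
  assumes lab_AP: "lab y \<in> AP"
    and Y_even: "y \<in> Y \<Longrightarrow> y i \<Longrightarrow> even i"
    and Y_separated: "b \<in> AP \<Longrightarrow> b' \<in> AP \<Longrightarrow> b \<noteq> b' \<Longrightarrow>
      \<exists>M. \<forall>m\<ge>M. \<forall>y\<in>Y. \<forall>y'\<in>Y. lab y = b \<longrightarrow> lab y' = b' \<longrightarrow> \<not> (y m \<and> y' m)"
begin

text \<open>The label enters only where the branch is true, and \<open>node y m\<close> depends only
  on the values below \<open>m\<close>. So two branches with the same label that first split at
  \<open>m\<close> differ at level \<open>m\<close> by that label, up to sign.\<close>

definition el :: "(nat \<Rightarrow> bool) \<Rightarrow> nat \<Rightarrow> (bool list \<Rightarrow>\<^sub>0 's coef)" where
  "el y i = sg (node y i) e + (if y i then lab y else 0)"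

definition t :: "(nat \<Rightarrow> bool) \<Rightarrow> nat \<Rightarrow> (bool list \<Rightarrow>\<^sub>0 's coef)" where
  "t y m = (\<Sum>i<m. q i *\<^sub>R el y i)"

definition T :: "nat \<Rightarrow> ((nat \<Rightarrow> bool) \<Rightarrow>\<^sub>0 's coef) \<Rightarrow> (bool list \<Rightarrow>\<^sub>0 's coef)" where
  "T m = lin_extend (\<lambda>y. rm (t y m))"

definition theta :: "nat \<Rightarrow> 's vec \<Rightarrow> (bool list \<Rightarrow>\<^sub>0 's coef)" where
  "theta m u = fst u + T m (snd u)"

definition Gn :: "nat \<Rightarrow> 's vec set" where
  "Gn m = {u. q m *\<^sub>R snd u \<in> AP \<and> ky (snd u) \<subseteq> Y \<and> theta m u \<in> AP}"

definition G :: "'s vec set" where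
  "G = (\<Union>m. Gn m)"

definition gg :: "(nat \<Rightarrow> bool) \<Rightarrow> nat \<Rightarrow> 's coef \<Rightarrow> 's vec" where
  "gg y m a = (- (1 / q m) *\<^sub>R rm (t y m) a, sg y ((1 / q m) *\<^sub>R a))"

definition act :: "'s vec \<Rightarrow> 's coef \<Rightarrow> 's vec" where
  "act u a = (rm (fst u) a, rm (snd u) a)"

lemma el_AP: "el y i \<in> AP"
  by (auto simp: el_def e_in AP_0 lab_AP intro!: AP_add)

lemma q_Ints [simp]: "q m \<in> \<int>"
  by (metis Ints_of_nat of_nat_fact)

lemma t_AP: "t y m \<in> AP"
  unfolding t_def by (intro AP_sum AP_scale el_AP) simp

lemma t_Suc: "t y (Suc m) = t y m + q m *\<^sub>R el y m"
  by (simp add: t_def)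

lemma linear_T: "linear (T m)"
  unfolding T_def by (intro linear_lin_extend linear_rm_right)

lemma linear_theta: "linear (theta m)"
  unfolding theta_def[abs_def]
  by (rule linearI) (simp_all add: linear_add[OF linear_T] linear_scale[OF linear_T] algebra_simps)

lemma T_single: "T m (sg y a) = rm (t y m) a"
  unfolding T_def by (rule lin_extend_single) (rule linear_rm_right)

lemma T_Suc: "T (Suc m) d = T m d + q m *\<^sub>R lin_extend (\<lambda>y. rm (el y m)) d"
  by (simp add: T_def lin_extend_def t_Suc linear_add[OF linear_rm_left] linear_scale[OF linear_rm_left]
    sum.distrib scaleR_sum_right)

text \<open>The summands from level \<open>m\<close> on carry factorials divisible by
  \<open>q m\<close>, and \<open>d\<close> has coefficients in \<open>A\<close>.\<close>

lemma T_mod: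
  assumes "d \<in> AP" "m \<le> n"
  shows "\<exists>w\<in>AP. T n d = T m d + q m *\<^sub>R w"
  using assms(2)
proof (induction n rule: dec_induct)
  case base
  show ?case by (rule bexI[OF _ AP_0]) simp
next
  case (step n)
  then obtain w where w: "w \<in> AP" "T n d = T m d + q m *\<^sub>R w" by blast
  obtain k :: nat where k: "q n = real k * q m" using q_multiple step.hyps by blast
  let ?E = "lin_extend (\<lambda>y. rm (el y n)) d"
  have "T (Suc n) d = T m d + q m *\<^sub>R (w + real k *\<^sub>R ?E)"
    using w k by (simp add: T_Suc scaleR_add_right mult.commute)
  moreover have "w + real k *\<^sub>R ?E \<in> AP"
    using w assms(1) el_AP by (intro AP_add AP_scale lin_extend_rm_AP) auto
  ultimately show ?case by blast
qed

lemma Gn_sub: "add_subgroup (Gn m)"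
  unfolding add_subgroup_def
proof (intro conjI ballI)
  show "0 \<in> Gn m" by (simp add: Gn_def AP_0 linear_0[OF linear_theta])
  show "u - v \<in> Gn m" if "u \<in> Gn m" "v \<in> Gn m" for u v
  proof -
    have "ky (snd u - snd v) \<subseteq> Y"
      using that Poly_Mapping.keys_add[of "snd u" "- snd v"] by (auto simp: Gn_def)
    then show ?thesis
      using that by (auto simp: Gn_def linear_diff[OF linear_theta] scaleR_diff_right intro: AP_diff)
  qed
qed

text \<open>Raising the level adds to \<open>theta\<close> one layer of elements
  \<open>el y m\<close>, with coefficients from \<open>q m *\<^sub>R snd u\<close>, which lie in
  \<open>A\<close>.\<close>

lemma Gn_Suc:
  assumes "u \<in> Gn m"
  shows "u \<in> Gn (Suc m)"
proof -
  let ?E = "lin_extend (\<lambda>y. rm (el y m))"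
  have lin: "linear ?E" by (intro linear_lin_extend linear_rm_right)
  have "theta (Suc m) u = theta m u + ?E (q m *\<^sub>R snd u)"
    by (simp add: theta_def T_Suc linear_scale[OF lin])
  moreover have "\<dots> \<in> AP"
    using assms el_AP by (intro AP_add lin_extend_rm_AP) (auto simp: Gn_def)
  moreover have "q (Suc m) *\<^sub>R snd u \<in> AP"
    using AP_scale[of "q m *\<^sub>R snd u" "real (Suc m)"] assms by (simp add: Gn_def q_Suc del: fact_Suc)
  ultimately show ?thesis
    using assms by (simp add: Gn_def)
qed

lemma Gn_mono: "m \<le> n \<Longrightarrow> u \<in> Gn m \<Longrightarrow> u \<in> Gn n"
  by (induction n rule: dec_induct) (auto intro: Gn_Suc)

lemma G_sub: "add_subgroup G"
  unfolding add_subgroup_def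
proof (intro conjI ballI)
  show "0 \<in> G" using add_subgroup_0[OF Gn_sub] by (auto simp: G_def)
  fix u v assume "u \<in> G" "v \<in> G"
  then obtain m n where "u \<in> Gn m" "v \<in> Gn n" by (auto simp: G_def)
  then have "u \<in> Gn (max m n)" "v \<in> Gn (max m n)" by (auto elim!: Gn_mono[rotated])
  then have "u - v \<in> Gn (max m n)" by (rule add_subgroup_diff[OF Gn_sub])
  then show "u - v \<in> G" unfolding G_def by blast
qed

lemmas G_0 = add_subgroup_0[OF G_sub] and G_diff = add_subgroup_diff[OF G_sub]
  and G_add = add_subgroup_add[OF G_sub] and G_minus = add_subgroup_minus[OF G_sub]
  and G_sum = add_subgroup_sum[OF G_sub] and G_scale = add_subgroup_scale[OF G_sub]

lemma G_keys: "u \<in> G \<Longrightarrow> ky (snd u) \<subseteq> Y"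
  by (auto simp: G_def Gn_def)

text \<open>Every \<open>theta m\<close> is the identity on the first component, so adjoining the
  tail quotients creates no new element in the span of the nodes.\<close>

lemma G_base [simp]: "(b, 0) \<in> G \<longleftrightarrow> b \<in> AP"
  by (simp add: G_def Gn_def theta_def AP_0 linear_0[OF linear_T])

text \<open>At some level beyond \<open>m\<close> the value of \<open>theta\<close> at
  \<open>u\<close> lies in \<open>AP\<close>. Going back to level \<open>m\<close> costs a multiple
  of \<open>q m\<close> by \<open>T_mod\<close>, which applies because \<open>q m\<close> clears the
  denominators of \<open>snd u\<close>.\<close>

lemma theta_divisible:
  assumes u: "u \<in> G" and d: "q m *\<^sub>R snd u \<in> AP"
  shows "\<exists>w\<in>AP. theta m (q m *\<^sub>R u) = q m *\<^sub>R w"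
proof -
  obtain k where "u \<in> Gn k" using u by (auto simp: G_def)
  then have n: "u \<in> Gn (max k m)" by (rule Gn_mono[rotated]) simp
  obtain w where w: "w \<in> AP" "T (max k m) (q m *\<^sub>R snd u) = T m (q m *\<^sub>R snd u) + q m *\<^sub>R w"
    using T_mod[OF d max.cobounded2] by blast
  have "theta m (q m *\<^sub>R u) = q m *\<^sub>R (theta (max k m) u - w)"
    using w by (simp add: theta_def scaleR_add_right scaleR_diff_right linear_scale[OF linear_T])
  moreover have "theta (max k m) u - w \<in> AP"
    using n w by (intro AP_diff) (auto simp: Gn_def)
  ultimately show ?thesis by blast
qed

lemma gg_in:
  assumes "y \<in> Y" "a \<in> A"
  shows "gg y m a \<in> G"
proof -
  have "theta m (gg y m a) = 0"
    by (simp add: theta_def gg_def T_single linear_scale[OF linear_rm_right])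
  then have "gg y m a \<in> Gn m"
    using assms by (auto simp: Gn_def AP_0 gg_def scaleR_single)
  then show ?thesis by (auto simp: G_def)
qed

lemma gg_0: "gg y 0 a = (0, sg y a)"
  by (simp add: gg_def t_def linear_0[OF linear_rm_left])

text \<open>A tail is its first term plus the next tail; after division by \<open>q m\<close>, the
  factor \<open>m + 1\<close> remains in front of the next quotient.\<close>

lemma gg_Suc: "gg y m a = real (Suc m) *\<^sub>R gg y (Suc m) a + (rm (el y m) a, 0)"
proof -
  have eq: "real (Suc m) / q (Suc m) = 1 / q m"
    by (simp add: field_simps del: of_nat_Suc)
  have "rm (t y (Suc m)) a = rm (t y m) a + q m *\<^sub>R rm (el y m) a"
    by (simp add: t_Suc linear_add[OF linear_rm_left] linear_scale[OF linear_rm_left])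
  then have "(1 / q m) *\<^sub>R rm (t y (Suc m)) a = (1 / q m) *\<^sub>R rm (t y m) a + rm (el y m) a"
    by (simp add: scaleR_add_right)
  then show ?thesis
    by (simp add: gg_def scaleR_single eq del: of_nat_Suc fact_Suc)
qed

text \<open>The tail quotients absorb the branch coefficients, and \<open>theta m u\<close> is what
  remains in the first component. For \<open>u\<close> in \<open>Gn m\<close> this shows that nodes
  and tail quotients generate.\<close>

lemma Gn_decompose:
  "u = (theta m u, 0) + (\<Sum>y\<in>ky (snd u). gg y m (q m *\<^sub>R lk (snd u) y))"
proof (rule prod_eqI)
  show "snd u = snd ((theta m u, 0) + (\<Sum>y\<in>ky (snd u). gg y m (q m *\<^sub>R lk (snd u) y)))"
    by (simp add: snd_sum gg_def flip: pm_sum_single)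
  show "fst u = fst ((theta m u, 0) + (\<Sum>y\<in>ky (snd u). gg y m (q m *\<^sub>R lk (snd u) y)))"
    by (simp add: fst_sum gg_def theta_def T_def lin_extend_def linear_scale[OF linear_rm_right] sum_negf)
qed

text \<open>Separates a branch element into a partial sum and a multiple of \<open>q m\<close>, so
  comparisons modulo \<open>q m\<close> reduce to nodes.\<close>

lemma gg_telescope: "gg y 0 a = (rm (t y m) a, 0) + q m *\<^sub>R gg y m a"
  by (simp add: gg_0) (simp add: gg_def scaleR_single)

lemma linear_act_left: "linear (\<lambda>u. act u a)"
  by (rule linearI) (simp_all add: act_def linear_add[OF linear_rm_left] linear_scale[OF linear_rm_left])

lemma linear_act_right: "linear (act u)"
  by (rule linearI) (simp_all add: act_def linear_add[OF linear_rm_right] linear_scale[OF linear_rm_right])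

lemma theta_act: "theta m (act u a) = rm (theta m u) a"
  by (simp add: theta_def act_def T_def rm_lin_extend linear_add[OF linear_rm_left])

lemma act_in:
  assumes "u \<in> G" "a \<in> A"
  shows "act u a \<in> G"
proof -
  obtain m where "u \<in> Gn m" using assms by (auto simp: G_def)
  then have "act u a \<in> Gn m"
    using keys_rm[of "snd u" a] assms(2)
    by (auto simp: Gn_def theta_act rm_AP) (auto simp: act_def rm_AP simp flip: linear_scale[OF linear_rm_left])
  then show ?thesis by (auto simp: G_def)
qed

lemma act_act: "act (act u a) b = act u (mul a b)"
  by (simp add: act_def rm_rm)

lemma rm_e: "p \<in> AP \<Longrightarrow> rm p e = p"
  by (rule poly_mapping_eqI) (simp add: AP_lookup mul_e_right)

lemma Gn_numerator:
  assumes "u \<in> Gn m"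
  shows "q m *\<^sub>R fst u \<in> AP" "q m *\<^sub>R snd u \<in> AP"
proof -
  show s: "q m *\<^sub>R snd u \<in> AP" using assms by (simp add: Gn_def)
  have "q m *\<^sub>R fst u = q m *\<^sub>R theta m u - T m (q m *\<^sub>R snd u)"
    by (simp add: theta_def scaleR_add_right linear_scale[OF linear_T])
  also have "\<dots> \<in> AP"
    unfolding T_def using assms
    by (intro AP_diff[OF AP_scale[OF _ q_Ints] lin_extend_rm_AP[OF t_AP s]]) (simp add: Gn_def)
  finally show "q m *\<^sub>R fst u \<in> AP" .
qed

lemma act_e:
  assumes "u \<in> G"
  shows "act u e = u"
proof -
  obtain m where "u \<in> Gn m" using assms by (auto simp: G_def)
  \<comment> \<open>The unit law holds on \<open>AP\<close>, so it is applied to the numerators and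
    the factor \<open>q m\<close> is cancelled.\<close>
  then have "q m *\<^sub>R act u e = q m *\<^sub>R u"
    by (simp add: prod_eq_iff act_def Gn_numerator rm_e flip: linear_scale[OF linear_rm_left])
  then show ?thesis by simp
qed

end

section \<open>Countable subsets embed into a free abelian group\<close>

context branch_module
begin

lemma linear_gg: "linear (gg y m)"
  by (rule linearI)
    (simp_all add: gg_def linear_add[OF linear_rm_right] linear_scale[OF linear_rm_right]
      scaleR_add_right single_add scaleR_single mult.commute)

lemma base_in_subgroup:
  assumes S: "add_subgroup S" and "b \<in> AP"
    and "\<And>x a. x \<in> ky b \<Longrightarrow> a \<in> A \<Longrightarrow> (sg x a, 0) \<in> S"
  shows "(b, 0) \<in> (S :: 's vec set)"
proof -
  have "(b, 0) = (\<Sum>x\<in>ky b. (sg x (lk b x), 0 :: (nat \<Rightarrow> bool) \<Rightarrow>\<^sub>0 's coef))"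
    by (rule prod_eqI) (simp_all add: fst_sum snd_sum flip: pm_sum_single)
  also have "\<dots> \<in> S"
    using assms by (intro add_subgroup_sum[OF S]) (auto simp: AP_lookup)
  finally show ?thesis .
qed

text \<open>Enumerate \<open>Z\<close>. Up to a given branch there are only finitely many branches,
  each with finitely many nodes in its label, and distinct branches eventually part; so every
  condition on \<open>n y\<close> holds from some level on. Labels of later branches are not
  restricted.\<close>

lemma exists_tails:
  assumes "countable Z"
  shows "\<exists>(\<kappa> :: (nat \<Rightarrow> bool) \<Rightarrow> nat) n. inj_on \<kappa> Z \<and> (\<forall>y\<in>Z. \<forall>y'\<in>Z. \<forall>i\<ge>n y. \<kappa> y' \<le> \<kappa> y \<longrightarrow>
    node y i \<notin> ky (lab y') \<and> (y' \<noteq> y \<longrightarrow> node y i \<noteq> node y' i))"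
proof -
  let ?\<kappa> = "to_nat_on Z"
  have inj: "inj_on ?\<kappa> Z" using assms by (rule inj_on_to_nat_on)
  have "\<exists>N. \<forall>i\<ge>N. \<forall>y'\<in>{y'\<in>Z. ?\<kappa> y' \<le> ?\<kappa> y}. node y i \<notin> ky (lab y') \<and> (y' \<noteq> y \<longrightarrow> node y i \<noteq> node y' i)" for y
  proof -
    have fin: "finite {y'\<in>Z. ?\<kappa> y' \<le> ?\<kappa> y}"
      by (rule inj_on_finite[of ?\<kappa> _ "{..?\<kappa> y}"]) (use inj in \<open>auto simp: inj_on_def\<close>)
    have 1: "\<forall>\<^sub>F i in sequentially. node y i \<notin> ky (lab y')" for y'
    proof -
      have "\<forall>\<^sub>F i in sequentially. node y i \<noteq> x" for x
        using eventually_gt_at_top[of "length x"] by eventually_elim auto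
      then have "\<forall>\<^sub>F i in sequentially. \<forall>x\<in>ky (lab y'). node y i \<noteq> x"
        by (intro eventually_ball_finite) auto
      then show ?thesis by eventually_elim auto
    qed
    have 2: "\<forall>\<^sub>F i in sequentially. y' \<noteq> y \<longrightarrow> node y i \<noteq> node y' i" for y'
    proof (cases "y' = y")
      case False
      then obtain k where "y' k \<noteq> y k" by blast
      have "\<forall>\<^sub>F i in sequentially. node y i \<noteq> node y' i"
        using eventually_gt_at_top[of k]
      proof eventually_elim
        case (elim i)
        then show ?case using \<open>y' k \<noteq> y k\<close> by (auto simp: node_eq_iff)
      qed
      then show ?thesis by (rule eventually_mono) simp
    qed simp
    have "\<forall>\<^sub>F i in sequentially. \<forall>y'\<in>{y'\<in>Z. ?\<kappa> y' \<le> ?\<kappa> y}. node y i \<notin> ky (lab y') \<and> (y' \<noteq> y \<longrightarrow> node y i \<noteq> node y' i)"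
      by (rule eventually_ball_finite[OF fin]) (use 1 2 in \<open>auto simp: eventually_conj_iff\<close>)
    then show ?thesis by (simp add: eventually_sequentially)
  qed
  then obtain n where "\<forall>y. \<forall>i\<ge>n y. \<forall>y'\<in>{y'\<in>Z. ?\<kappa> y' \<le> ?\<kappa> y}. node y i \<notin> ky (lab y') \<and> (y' \<noteq> y \<longrightarrow> node y i \<noteq> node y' i)"
    by metis
  then show ?thesis using inj by (intro exI[of _ ?\<kappa>] exI[of _ n]) blast
qed

end

section \<open>Exchanging the nodes of branch tails for tail quotients\<close>

locale branch_tails = branch_module A mul e Y lab
  for A :: "'s coef set" and mul e Y lab +
  fixes Z :: "(nat \<Rightarrow> bool) set" and \<kappa> :: "(nat \<Rightarrow> bool) \<Rightarrow> nat" and n :: "(nat \<Rightarrow> bool) \<Rightarrow> nat"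
  assumes \<kappa>_inj: "inj_on \<kappa> Z"
    and tail_lab: "y \<in> Z \<Longrightarrow> y' \<in> Z \<Longrightarrow> \<kappa> y' \<le> \<kappa> y \<Longrightarrow> n y \<le> i \<Longrightarrow> node y i \<notin> ky (lab y')"
    and tail_node: "y \<in> Z \<Longrightarrow> y' \<in> Z \<Longrightarrow> \<kappa> y' \<le> \<kappa> y \<Longrightarrow> n y \<le> i \<Longrightarrow> y' \<noteq> y \<Longrightarrow> node y i \<noteq> node y' i"
begin

definition tail_of :: "bool list \<Rightarrow> (nat \<Rightarrow> bool) \<Rightarrow> bool" where
  "tail_of x y \<longleftrightarrow> y \<in> Z \<and> n y \<le> length x \<and> x = node y (length x)"

lemma tail_of_node [simp]: "tail_of (node y i) y \<longleftrightarrow> y \<in> Z \<and> n y \<le> i"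
  by (auto simp: tail_of_def)

lemma tail_of_unique: "tail_of x y \<Longrightarrow> tail_of x y' \<Longrightarrow> y = y'"
  unfolding tail_of_def using tail_node[of y y'] tail_node[of y' y] by (cases "\<kappa> y \<le> \<kappa> y'") force+

text \<open>A node on a tail is replaced by the tail quotient that starts there. Tails are pairwise
  disjoint by \<open>tail_of_unique\<close>, so \<open>THE\<close> is well defined.\<close>

definition basis :: "bool list \<Rightarrow> 's coef \<Rightarrow> 's vec" where
  "basis x a = (if \<exists>y. tail_of x y then gg (THE y. tail_of x y) (length x) a else (sg x a, 0))"

lemma basis_tail: "tail_of x y \<Longrightarrow> basis x a = gg y (length x) a"
  unfolding basis_def using tail_of_unique by (metis the_equality)

lemma basis_not_tail: "(\<And>y. \<not> tail_of x y) \<Longrightarrow> basis x a = (sg x a, 0)"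
  by (simp add: basis_def)

lemma linear_basis: "linear (basis x)"
proof (cases "\<exists>y. tail_of x y")
  case True
  then show ?thesis using linear_gg basis_tail by (metis (no_types, lifting) ext)
next
  case False
  then show ?thesis
    by (auto simp: basis_def[abs_def] single_add scaleR_single intro!: linearI)
qed

text \<open>The coordinate map of the new basis. It is injective on \<open>AP\<close> and reaches
  every element of \<open>G\<close> whose branches are in \<open>Z\<close>, so its inverse embeds
  these elements into a free module.\<close>

definition chi :: "(bool list \<Rightarrow>\<^sub>0 's coef) \<Rightarrow> 's vec" where
  "chi = lin_extend basis"

lemma linear_chi: "linear chi"
  unfolding chi_def by (intro linear_lin_extend linear_basis)

lemma chi_single: "chi (sg x a) = basis x a"
  unfolding chi_def by (intro lin_extend_single linear_basis)

lemma image_sub: "add_subgroup (chi ` AP)"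
  by (intro add_subgroup_image AP_sub linear_chi)

lemma basis_in: "a \<in> A \<Longrightarrow> basis x a \<in> chi ` AP"
  using chi_single by (metis AP_single imageI)

text \<open>Induction along \<open>\<kappa>\<close>: \<open>gg_Suc\<close> expresses the node
  through two consecutive tail quotients and the label, whose nodes lie off all tails or on tails of
  earlier branches.\<close>

lemma tail_in:
  assumes "y \<in> Z" "n y \<le> i" "a \<in> A"
  shows "(sg (node y i) a, 0) \<in> chi ` AP"
  using assms
proof (induction "\<kappa> y" arbitrary: y i a rule: less_induct)
  case less
  have lab_in: "(rm (lab y) a, 0) \<in> chi ` AP"
  proof (rule base_in_subgroup[OF image_sub])
    show "rm (lab y) a \<in> AP" using less.prems lab_AP by (intro rm_AP)
    fix x c assume x: "x \<in> ky (rm (lab y) a)" and c: "c \<in> A"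
    show "(sg x c, 0) \<in> chi ` AP"
    proof (cases "\<exists>y'. tail_of x y'")
      case True
      then obtain y' where y': "y' \<in> Z" "n y' \<le> length x" "x = node y' (length x)"
        by (auto simp: tail_of_def)
      \<comment> \<open>Otherwise the tail of \<open>y'\<close> would avoid the label of
        \<open>y\<close>, in which \<open>x\<close> occurs.\<close>
      have "\<kappa> y' < \<kappa> y"
        using tail_lab[OF y'(1) less.prems(1) _ y'(2)] x y'(3) keys_rm[of "lab y" a]
        by (metis not_le subsetD)
      from less.hyps[OF this y'(1,2) c] y'(3) show ?thesis by simp
    next
      case False
      then show ?thesis using basis_in[OF c, of x] by (simp add: basis_not_tail)
    qed
  qed
  have "mul e a = a" using less.prems by (simp add: mul_e_left)
  then have "(sg (node y i) a, 0) = gg y i a - real (Suc i) *\<^sub>R gg y (Suc i) a - (if y i then (rm (lab y) a, 0) else 0)"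
    by (subst gg_Suc) (simp add: el_def linear_add[OF linear_rm_left] linear_0[OF linear_rm_left] rm_single)
  also have "\<dots> \<in> chi ` AP"
  proof -
    have g: "gg y j a \<in> chi ` AP" if "i \<le> j" for j
      using basis_in[OF less.prems(3), of "node y j"] basis_tail[of "node y j" y a] less.prems that by simp
    show ?thesis
      using g lab_in add_subgroup_0[OF image_sub]
      by (intro add_subgroup_diff[OF image_sub] add_subgroup_scale[OF image_sub]) (auto simp del: of_nat_Suc)
  qed
  finally show ?case .
qed

lemma base_in:
  assumes "b \<in> AP"
  shows "(b, 0) \<in> chi ` AP"
proof (rule base_in_subgroup[OF image_sub assms])
  fix x a assume a: "a \<in> A"
  show "(sg x a, 0) \<in> chi ` AP"
  proof (cases "\<exists>y. tail_of x y")
    case True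
    then show ?thesis using tail_in a by (metis tail_of_def)
  next
    case False
    then show ?thesis using basis_in[OF a, of x] by (simp add: basis_not_tail)
  qed
qed

text \<open>Quotients starting on the tail are basis elements; \<open>gg_Suc\<close> reaches the
  others by descending induction.\<close>

lemma gg_in_image:
  assumes "y \<in> Z" "a \<in> A"
  shows "gg y m a \<in> chi ` AP"
proof -
  have large: "gg y i a \<in> chi ` AP" if "n y \<le> i" for i
    using basis_in[OF assms(2), of "node y i"] basis_tail[of "node y i" y a] assms that by simp
  show ?thesis
  proof (cases "n y \<le> m")
    case False
    then have "m \<le> n y" by simp
    then show ?thesis
    proof (induction m rule: inc_induct)
      case (step k)
      then show ?case
        using assms el_AP by (subst gg_Suc)
          (intro add_subgroup_add[OF image_sub] add_subgroup_scale[OF image_sub] base_in rm_AP, simp_all)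
    qed (simp add: large)
  qed (rule large)
qed

lemma G_in_image:
  assumes "u \<in> G" "ky (snd u) \<subseteq> Z"
  shows "u \<in> chi ` AP"
proof -
  obtain m where m: "u \<in> Gn m" using assms by (auto simp: G_def)
  have A: "q m *\<^sub>R lk (snd u) y \<in> A" for y
    using AP_lookup[of "q m *\<^sub>R snd u" y] m by (simp add: Gn_def)
  have "(theta m u, 0) + (\<Sum>y\<in>ky (snd u). gg y m (q m *\<^sub>R lk (snd u) y)) \<in> chi ` AP"
    using m A assms(2)
    by (intro add_subgroup_add[OF image_sub] add_subgroup_sum[OF image_sub] base_in gg_in_image) (auto simp: Gn_def)
  then show ?thesis by (simp flip: Gn_decompose)
qed

text \<open>The triangularity behind injectivity: a tail node of \<open>y\<close> does not occur in
  the terms of earlier branches, nor in those of \<open>y\<close> at smaller levels.\<close>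

lemma el_at_later_tail:
  assumes "y \<in> Z" "y' \<in> Z" "\<kappa> y' \<le> \<kappa> y" "n y \<le> j" "y' \<noteq> y \<or> k < j"
  shows "lk (el y' k) (node y j) = 0"
proof -
  have "node y' k \<noteq> node y j"
    using assms tail_node[OF assms(1-4)] by (metis length_node less_irrefl)
  then show ?thesis
    using tail_lab[OF assms(1-4)] by (auto simp: el_def lookup_add lookup_single when_def in_keys_iff)
qed

lemma t_at_later_tail:
  assumes "y \<in> Z" "y' \<in> Z" "\<kappa> y' \<le> \<kappa> y" "n y \<le> j" "y' \<noteq> y \<or> m \<le> j"
  shows "lk (t y' m) (node y j) = 0"
  unfolding t_def lookup_sum
proof (rule sum.neutral, rule ballI)
  fix k assume "k \<in> {..<m}"
  then show "lk (q k *\<^sub>R el y' k) (node y j) = 0"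
    using el_at_later_tail[OF assms(1-4), of k] assms(5) by auto
qed

text \<open>If tail nodes occurred in \<open>f\<close>, take the latest branch \<open>y\<close>
  having one and the deepest of its nodes, at level \<open>i\<close>. Some coordinate of
  \<open>chi f\<close> receives a contribution from this node alone, so its coefficient would
  vanish. Without tail nodes, \<open>chi f\<close> has first component \<open>f\<close>.\<close>

lemma chi_zero:
  assumes f: "f \<in> AP" and zero: "chi f = 0"
  shows "f = 0"
proof -
  have unique_term: "l (basis x (lk f x)) = 0"
    if l: "linear l" and x: "x \<in> ky f" and others: "\<And>x'. x' \<in> ky f \<Longrightarrow> x' \<noteq> x \<Longrightarrow> l (basis x' (lk f x')) = 0"
    for l :: "'s vec \<Rightarrow> 's coef" and x
  proof -
    have "0 = l (chi f)" using linear_0[OF l] zero by simp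
    also have "\<dots> = (\<Sum>x'\<in>ky f. l (basis x' (lk f x')))"
      by (simp add: chi_def lin_extend_def linear_sum[OF l])
    also have "\<dots> = l (basis x (lk f x))"
      using x others by (subst sum.remove[of _ x]) auto
    finally show ?thesis by simp
  qed
  have no_tail: "\<not> tail_of x y" if "x \<in> ky f" for x y
  proof
    assume "tail_of x y"
    define W where "W = {y. \<exists>x\<in>ky f. tail_of x y}"
    have "W \<subseteq> (\<lambda>x. THE y. tail_of x y) ` ky f"
    proof
      fix y assume "y \<in> W"
      then obtain x where x: "x \<in> ky f" "tail_of x y" by (auto simp: W_def)
      then have "y = (THE y. tail_of x y)" using tail_of_unique by (metis the_equality)
      then show "y \<in> (\<lambda>x. THE y. tail_of x y) ` ky f" using x by blast
    qed
    then have finW: "finite W" by (rule finite_subset) simp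
    moreover have "W \<noteq> {}" using \<open>tail_of x y\<close> that by (auto simp: W_def)
    ultimately have "Max (\<kappa> ` W) \<in> \<kappa> ` W" by (intro Max_in) auto
    then obtain y where y: "y \<in> W" "\<And>y'. y' \<in> W \<Longrightarrow> \<kappa> y' \<le> \<kappa> y"
      using finW by (metis (no_types, lifting) Max_ge finite_imageI image_iff)
    define J where "J = {i. n y \<le> i \<and> node y i \<in> ky f}"
    have "finite J"
      by (rule finite_subset[of _ "length ` ky f"]) (auto simp: J_def intro!: image_eqI[of _ _ "node y _"])
    moreover have "J \<noteq> {}" using y(1) by (auto simp: J_def W_def tail_of_def)
    ultimately obtain i where i: "i \<in> J" "\<And>j. j \<in> J \<Longrightarrow> j \<le> i"
      using Max_in Max_ge by metis
    have yZ: "y \<in> Z" using y(1) by (auto simp: W_def tail_of_def)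
    have ti: "tail_of (node y i) y" and ki: "node y i \<in> ky f" and ni: "n y \<le> i"
      using i(1) yZ by (auto simp: J_def)
    let ?a = "lk f (node y i)"
    have a: "?a \<noteq> 0" "?a \<in> A" using ki f by (auto simp: in_keys_iff AP_lookup)
    have others: "tail_of x y' \<Longrightarrow> (y' \<noteq> y \<and> \<kappa> y' \<le> \<kappa> y \<and> y' \<in> Z) \<or> (y' = y \<and> x = node y (length x) \<and> length x < i \<and> n y \<le> length x)"
      if x: "x \<in> ky f" "x \<noteq> node y i" for x y'
    proof (cases "y' = y")
      case True
      assume "tail_of x y'"
      then have "x = node y (length x)" "length x \<in> J" using True x by (auto simp: tail_of_def J_def)
      then show ?thesis using i(2)[of "length x"] x True by (auto simp: J_def le_less)
    next
      case False
      assume "tail_of x y'"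
      then show ?thesis using False y(2)[of y'] x by (auto simp: W_def tail_of_def)
    qed
    show False
    proof (cases "i = n y")
      case True
      \<comment> \<open>The deepest node is also the first of its tail, so no other basis element in
        \<open>chi f\<close> involves the branch \<open>y\<close>.\<close>
      have "lk (snd (basis (node y i) ?a)) y = 0"
      proof (rule unique_term[of "\<lambda>u. lk (snd u) y"])
        show "linear (\<lambda>u :: 's vec. lk (snd u) y)" by (rule linearI) (simp_all add: lookup_add)
        show "node y i \<in> ky f" by fact
        fix x assume x: "x \<in> ky f" "x \<noteq> node y i"
        show "lk (snd (basis x (lk f x))) y = 0"
        proof (cases "\<exists>y'. tail_of x y'")
          case t: True
          then obtain y' where "tail_of x y'" by blast
          then show ?thesis using others[OF x, of y'] True
            by (auto simp: basis_tail gg_def lookup_single)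
        qed (simp add: basis_not_tail)
      qed
      then show False using a by (simp add: basis_tail[OF ti] gg_def)
    next
      case False
      \<comment> \<open>Here the coordinate is the preceding node \<open>node y j\<close>: the
        partial sum of length \<open>i\<close> contains it, but shorter ones along \<open>y\<close>
        and those along earlier branches do not.\<close>
      then obtain j where j: "i = Suc j" "n y \<le> j" using ni by (cases i) auto
      have "lk (fst (basis (node y i) ?a)) (node y j) = 0"
      proof (rule unique_term[of "\<lambda>u. lk (fst u) (node y j)"])
        show "linear (\<lambda>u :: 's vec. lk (fst u) (node y j))" by (rule linearI) (simp_all add: lookup_add)
        show "node y i \<in> ky f" by fact
        fix x assume x: "x \<in> ky f" "x \<noteq> node y i"
        show "lk (fst (basis x (lk f x))) (node y j) = 0"
        proof (cases "\<exists>y'. tail_of x y'")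
          case t: True
          then obtain y' where y': "tail_of x y'" by blast
          then have "lk (t y' (length x)) (node y j) = 0"
            using others[OF x y'] yZ j by (intro t_at_later_tail) auto
          then show ?thesis using y' by (simp add: basis_tail gg_def)
        next
          case f: False
          then have "x \<noteq> node y j" using yZ j by (metis tail_of_node)
          then show ?thesis using f by (simp add: basis_not_tail lookup_single)
        qed
      qed
      moreover have "lk (t y i) (node y j) = q j *\<^sub>R e"
        using t_at_later_tail[OF yZ yZ, of j j] tail_lab[OF yZ yZ, of j] j
        by (auto simp: t_Suc el_def lookup_add in_keys_iff)
      ultimately show False
        using a by (simp add: basis_tail[OF ti] gg_def linear_scale[OF linear_mul_left] mul_e_left)
    qed
  qed
  have "chi f = (\<Sum>x\<in>ky f. (sg x (lk f x), 0))"
    unfolding chi_def lin_extend_def using no_tail by (intro sum.cong) (auto simp: basis_not_tail)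
  then have "fst (chi f) = f"
    by (simp add: fst_sum flip: pm_sum_single)
  then show ?thesis using zero by simp
qed

lemma chi_inj: "inj_on chi AP"
proof (rule inj_onI)
  fix f f' assume f: "f \<in> AP" "f' \<in> AP" "chi f = chi f'"
  then have "chi (f - f') = 0" by (simp add: linear_diff[OF linear_chi])
  then show "f = f'" using chi_zero[OF AP_diff[OF f(1,2)]] by simp
qed

end

section \<open>Integer coordinates and divisibility\<close>

context branch_module
begin

text \<open>Turns nested vectors into the integer vectors on which free abelian groups of
  HOL-Algebra are built. On \<open>AP\<close> the floor merely changes the type, as all coefficients
  are integers.\<close>

definition flat :: "(bool list \<Rightarrow>\<^sub>0 's coef) \<Rightarrow> (bool list \<times> 's \<Rightarrow>\<^sub>0 int)" where
  "flat p = Abs_poly_mapping (\<lambda>(x, s). \<lfloor>lk (lk p x) s\<rfloor>)"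

lemma lookup_flat: "lk (flat p) (x, s) = \<lfloor>lk (lk p x) s\<rfloor>"
proof -
  have "finite {k. (case k of (x, s) \<Rightarrow> \<lfloor>lk (lk p x) s\<rfloor>) \<noteq> 0}"
    by (rule finite_subset[of _ "Sigma (ky p) (\<lambda>x. ky (lk p x))"]) (auto simp: in_keys_iff)
  then show ?thesis unfolding flat_def by (subst lookup_Abs_poly_mapping) auto
qed

lemma flat_add:
  assumes "p \<in> AP" "p' \<in> AP"
  shows "flat (p + p') = flat p + flat p'"
proof (rule poly_mapping_eqI)
  fix k :: "bool list \<times> 's"
  obtain x s where k: "k = (x, s)" by fastforce
  have "lk (lk p x) s \<in> \<int>" using assms by (intro A_int AP_lookup)
  then show "lk (flat (p + p')) k = lk (flat p + flat p') k"
    unfolding k by (simp add: lookup_flat lookup_add floor_add2)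
qed

lemma flat_inj: "inj_on flat AP"
proof (rule inj_onI, rule poly_mapping_eqI, rule poly_mapping_eqI)
  fix p p' x s assume p: "p \<in> AP" "p' \<in> AP" "flat p = flat p'"
  then have "\<lfloor>lk (lk p x) s\<rfloor> = \<lfloor>lk (lk p' x) s\<rfloor>" by (metis lookup_flat)
  moreover have "lk (lk p x) s \<in> \<int>" "lk (lk p' x) s \<in> \<int>"
    using p by (auto intro: A_int AP_lookup)
  ultimately show "lk (lk p x) s = lk (lk p' x) s"
    by (auto elim!: Ints_cases)
qed

text \<open>The embedding is the inverse of \<open>chi\<close> followed by \<open>flat\<close>. It
  serves both for the freeness of countable subgroups and for excluding divisible elements.\<close>

lemma countable_embedding:
  assumes "countable Z"
  shows "\<exists>\<psi> :: 's vec \<Rightarrow> (bool list \<times> 's \<Rightarrow>\<^sub>0 int). inj_on \<psi> {u \<in> G. ky (snd u) \<subseteq> Z} \<and>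
    (\<forall>u\<in>{u \<in> G. ky (snd u) \<subseteq> Z}. \<forall>v\<in>{u \<in> G. ky (snd u) \<subseteq> Z}. \<psi> (u + v) = \<psi> u + \<psi> v)"
proof -
  obtain \<kappa> n where "inj_on \<kappa> Z" "\<forall>y\<in>Z. \<forall>y'\<in>Z. \<forall>i\<ge>n y. (\<kappa> y' :: nat) \<le> \<kappa> y \<longrightarrow>
    node y i \<notin> ky (lab y') \<and> (y' \<noteq> y \<longrightarrow> node y i \<noteq> node y' i)"
    using exists_tails[OF assms] by (elim exE conjE) (rule that)
  then interpret branch_tails A mul e Y lab Z \<kappa> n
    by unfold_locales blast+
  let ?i = "inv_into AP chi"
  let ?S = "{u \<in> G. ky (snd u) \<subseteq> Z}"
  have inv: "?i u \<in> AP" "chi (?i u) = u" if "u \<in> ?S" for u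
    using G_in_image[of u] that by (auto intro: inv_into_into f_inv_into_f)
  have add: "?i (u + v) = ?i u + ?i v" if "u \<in> ?S" "v \<in> ?S" for u v
  proof -
    have "u + v = chi (?i u + ?i v)"
      using inv that by (simp add: linear_add[OF linear_chi])
    moreover have "?i u + ?i v \<in> AP" using inv that by (intro AP_add) auto
    ultimately show ?thesis using chi_inj by (metis inv_into_f_f)
  qed
  show ?thesis
  proof (intro exI[of _ "\<lambda>u. flat (?i u)"] conjI ballI)
    show "inj_on (\<lambda>u. flat (?i u)) ?S"
    proof (rule inj_onI)
      fix u v assume uv: "u \<in> ?S" "v \<in> ?S" "flat (?i u) = flat (?i v)"
      have "?i u = ?i v"
        by (rule inj_onD[OF flat_inj uv(3) inv(1)[OF uv(1)] inv(1)[OF uv(2)]])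
      then have "chi (?i u) = chi (?i v)" by simp
      then show "u = v" by (simp only: inv(2)[OF uv(1)] inv(2)[OF uv(2)])
    qed
    show "flat (?i (u + v)) = flat (?i u) + flat (?i v)" if "u \<in> ?S" "v \<in> ?S" for u v
      unfolding add[OF that] by (rule flat_add[OF inv(1)[OF that(1)] inv(1)[OF that(2)]])
  qed
qed

text \<open>Quotients of \<open>z\<close> by positive integers have the same branches as
  \<open>z\<close>, so a single embedding into integer vectors covers them all; there a nonzero
  coordinate has only finitely many divisors.\<close>

lemma divisible_zero:
  assumes z: "z \<in> G" and inf: "infinite M" and div: "\<And>m. m \<in> M \<Longrightarrow> \<exists>v\<in>G. z = real m *\<^sub>R v"
  shows "z = 0"
proof -
  let ?S = "{u \<in> G. ky (snd u) \<subseteq> ky (snd z)}"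
  have "countable (ky (snd z))" by (rule countable_finite) simp
  from countable_embedding[OF this]
  obtain \<psi> :: "'s vec \<Rightarrow> (bool list \<times> 's \<Rightarrow>\<^sub>0 int)" where inj: "inj_on \<psi> ?S"
    and add: "\<forall>u\<in>?S. \<forall>v\<in>?S. \<psi> (u + v) = \<psi> u + \<psi> v"
    by (elim exE conjE) (rule that)
  have S0: "0 \<in> ?S" using G_0 by simp
  have "\<psi> (0 + 0) = \<psi> 0 + \<psi> 0" using add S0 by blast
  then have \<psi>0: "\<psi> 0 = 0" by simp
  have "lk (\<psi> z) k = 0" for k
  proof (rule ccontr)
    assume nz: "lk (\<psi> z) k \<noteq> 0"
    have dvd: "int m dvd lk (\<psi> z) k" if m: "m \<in> M" "m > 0" for m
    proof -
      obtain v where v: "v \<in> G" "z = real m *\<^sub>R v" using div m(1) by blast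
      then have "v \<in> ?S" using m(2) keys_scaleR[of "real m" "snd v"] by auto
      have mul: "real j *\<^sub>R v \<in> ?S \<and> \<psi> (real j *\<^sub>R v) = frag_cmul (int j) (\<psi> v)" for j
      proof (induction j)
        case 0
        then show ?case using S0 \<psi>0 by simp
      next
        case (Suc j)
        have e: "real (Suc j) *\<^sub>R v = real j *\<^sub>R v + v" by (simp add: scaleR_add_left)
        have "real j *\<^sub>R v + v \<in> G" using Suc \<open>v \<in> ?S\<close> by (intro G_add) auto
        moreover have "ky (snd (real j *\<^sub>R v + v)) \<subseteq> ky (snd z)"
          using Poly_Mapping.keys_add[of "real j *\<^sub>R snd v" "snd v"] Suc \<open>v \<in> ?S\<close> by auto
        moreover have "\<psi> (real j *\<^sub>R v + v) = \<psi> (real j *\<^sub>R v) + \<psi> v"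
          using add Suc \<open>v \<in> ?S\<close> by blast
        then have "\<psi> (real j *\<^sub>R v + v) = frag_cmul (int (Suc j)) (\<psi> v)"
          using Suc by (simp add: frag_cmul_distrib)
        ultimately show ?case unfolding e by blast
      qed
      then have "\<psi> z = frag_cmul (int m) (\<psi> v)" using v by simp
      then show ?thesis by simp
    qed
    have "M \<subseteq> {..nat \<bar>lk (\<psi> z) k\<bar>}"
    proof
      fix m assume m: "m \<in> M"
      show "m \<in> {..nat \<bar>lk (\<psi> z) k\<bar>}"
      proof (cases "m = 0")
        case False
        then have "int m dvd lk (\<psi> z) k" using dvd m by simp
        then show ?thesis using nz dvd_imp_le_int[of "lk (\<psi> z) k" "int m"] by simp
      qed simp
    qed
    then show False using inf finite_subset by blast
  qed
  then have "\<psi> z = \<psi> 0" using \<psi>0 by (intro poly_mapping_eqI) simp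
  then show ?thesis using inj z S0 by (auto dest: inj_onD)
qed

end

section \<open>Cardinalities\<close>

text \<open>There are finitely many initial segments of length \<open>M\<close>, so two members
  share one; \<open>m\<close> is the first place where they differ, and the pair is ordered by its
  values there.\<close>

lemma infinite_branches_split:
  fixes F :: "(nat \<Rightarrow> bool) set"
  assumes "infinite F"
  shows "\<exists>m\<ge>M. \<exists>y\<in>F. \<exists>y'\<in>F. y m \<and> \<not> y' m \<and> (\<forall>k<m. y k = y' k)"
proof -
  have "(\<lambda>y. node y M) ` F \<subseteq> {l :: bool list. set l \<subseteq> UNIV \<and> length l \<le> M}"
    by auto
  then have "finite ((\<lambda>y. node y M) ` F)"
    by (rule finite_subset) (intro finite_lists_length_le finite)
  then have "\<not> inj_on (\<lambda>y. node y M) F"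
    using assms finite_imageD by blast
  then obtain y y' where y: "y \<in> F" "y' \<in> F" "node y M = node y' M" "y \<noteq> y'"
    by (auto simp: inj_on_def)
  define m where "m = (LEAST k. y k \<noteq> y' k)"
  have "\<exists>k. y k \<noteq> y' k" using y(4) by blast
  then have m: "y m \<noteq> y' m" unfolding m_def by (rule LeastI_ex)
  have below: "y k = y' k" if "k < m" for k
    using not_less_Least[of k "\<lambda>k. y k \<noteq> y' k"] that by (auto simp: m_def)
  have "M \<le> m"
    using y(3) m by (metis node_eq_iff not_le)
  then show ?thesis
    using y(1,2) m below by (cases "y m") (metis (full_types))+
qed

text \<open>Otherwise \<open>X\<close> would be a union of at most \<open>|A|\<close> finite
  sets.\<close>

lemma infinite_fibre:
  assumes A: "infinite A" and D: "|D| \<le>o |A|" and X: "|A| <o |X|" and f: "f ` X \<subseteq> D"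
  shows "\<exists>d\<in>D. infinite {x \<in> X. f x = d}"
proof (rule ccontr)
  assume "\<not> (\<exists>d\<in>D. infinite {x \<in> X. f x = d})"
  then have fin: "finite {x \<in> X. f x = d}" if "d \<in> D" for d
    using that by blast
  have "|\<Union>d\<in>D. {x \<in> X. f x = d}| \<le>o |A|"
    by (rule card_of_UNION_ordLeq_infinite[OF A D])
      (use fin A in \<open>auto intro: ordLess_imp_ordLeq finite_ordLess_infinite2\<close>)
  moreover have "(\<Union>d\<in>D. {x \<in> X. f x = d}) = X" using f by auto
  ultimately show False using X not_ordLess_ordLeq by metis
qed

lemma Times_ordLeq_infinite:
  assumes "infinite C" "|A| \<le>o |C|" "|B| \<le>o |C|"
  shows "|A \<times> B| \<le>o |C|"
  using assms card_of_Times_ordLeq_infinite_Field[of "|C|" A B] by (simp add: card_of_Card_order)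

lemma Fpow_ordLeq_infinite:
  assumes "infinite C" "|A| \<le>o |C|"
  shows "|Fpow A| \<le>o |C|"
proof (cases "finite A")
  case True
  then have "finite (Fpow A)" by (simp add: Fpow_Pow_finite)
  then show ?thesis using assms(1) by (intro ordLess_imp_ordLeq finite_ordLess_infinite2)
next
  case False
  then show ?thesis using assms(2) card_of_Fpow_infinite ordIso_ordLeq_trans by blast
qed

text \<open>A finitely supported function is determined by its graph over its keys, a finite subset
  of \<open>K \<times> A\<close>.\<close>

lemma poly_mapping_ordLeq_infinite:
  assumes "infinite C" "|K| \<le>o |C|" "|A| \<le>o |C|"
  shows "|{p :: 'k \<Rightarrow>\<^sub>0 'v::zero. ky p \<subseteq> K \<and> (\<forall>k. lk p k \<in> A)}| \<le>o |C|"
proof -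
  let ?g = "\<lambda>p :: 'k \<Rightarrow>\<^sub>0 'v. (\<lambda>k. (k, lk p k)) ` ky p"
  have "inj_on ?g UNIV"
  proof (rule inj_onI, rule poly_mapping_eqI)
    fix p p' k assume eq: "?g p = ?g p'"
    have "(k, lk p k) \<in> ?g p \<longleftrightarrow> lk p k \<noteq> 0" "(k, lk p' k) \<in> ?g p' \<longleftrightarrow> lk p' k \<noteq> 0"
      by (auto simp: in_keys_iff)
    then show "lk p k = lk p' k" using eq by (auto simp: image_iff)
  qed
  then have "|{p :: 'k \<Rightarrow>\<^sub>0 'v. ky p \<subseteq> K \<and> (\<forall>k. lk p k \<in> A)}| \<le>o |Fpow (K \<times> A)|"
    by (intro card_of_ordLeqI[where f = ?g]) (auto simp: Fpow_def intro: inj_on_subset)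
  also have "|Fpow (K \<times> A)| \<le>o |C|"
    using assms by (intro Fpow_ordLeq_infinite Times_ordLeq_infinite)
  finally show ?thesis .
qed

lemma countable_ordLeq_infinite:
  assumes "countable K" "infinite C"
  shows "|K| \<le>o |C|"
proof -
  have "|K| \<le>o |UNIV :: nat set|"
    using assms(1) by (intro card_of_ordLeqI[where f = "to_nat_on K"] inj_on_to_nat_on) simp_all
  also have "|UNIV :: nat set| \<le>o |C|"
    using assms(2) by (simp add: infinite_iff_card_of_nat)
  finally show ?thesis .
qed

lemma (in coefficient_ring) infinite_A: "infinite A"
proof -
  have "inj (\<lambda>n::nat. real n *\<^sub>R e)" using e_nonzero by (auto simp: inj_def)
  then have "infinite (range (\<lambda>n::nat. real n *\<^sub>R e))" by (rule range_inj_infinite)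
  moreover have "range (\<lambda>n::nat. real n *\<^sub>R e) \<subseteq> A" by (auto intro: A_scale e_in)
  ultimately show ?thesis using finite_subset by blast
qed

lemma (in coefficient_ring) AP_ordLeq: "|AP :: (bool list \<Rightarrow>\<^sub>0 's coef) set| \<le>o |A|"
  using poly_mapping_ordLeq_infinite[OF infinite_A countable_ordLeq_infinite[OF countableI_type infinite_A, of UNIV]
    ordLeq_refl[OF card_of_Card_order]]
  by (simp add: AP_def)

section \<open>Endomorphisms\<close>

context branch_module
begin

lemma t_cong:
  assumes "lab y = lab y'" "\<And>k. k < m \<Longrightarrow> y k = y' k"
  shows "t y m = t y' m"
proof -
  have "node y i = node y' i" if "i < m" for i
    using assms(2) that by (simp add: node_eq_iff)
  then show ?thesis
    unfolding t_def el_def using assms by (intro sum.cong) simp_all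
qed

text \<open>The partial sums up to \<open>m\<close> coincide, and so do the nodes at
  \<open>m\<close>, which record only values below \<open>m\<close>. Hence only a multiple of the
  label survives at level \<open>m\<close>.\<close>

lemma gg_diff:
  assumes "lab y = lab y'" "\<And>k. k < m \<Longrightarrow> y k = y' k"
  shows "gg y 0 d - gg y' 0 d =
    q m *\<^sub>R (((if y m then 1 else 0) - (if y' m then 1 else 0)) *\<^sub>R rm (lab y) d, 0) +
    q (Suc m) *\<^sub>R (gg y (Suc m) d - gg y' (Suc m) d)"
proof -
  have "node y m = node y' m" using assms(2) by (simp add: node_eq_iff)
  then have "el y m - el y' m = ((if y m then 1 else 0) - (if y' m then 1 else 0)) *\<^sub>R lab y"
    using assms(1) by (simp add: el_def)
  then have "t y (Suc m) - t y' (Suc m) = q m *\<^sub>R (((if y m then 1 else 0) - (if y' m then 1 else 0)) *\<^sub>R lab y)"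
    using t_cong[OF assms] by (simp add: t_Suc flip: scaleR_diff_right)
  then have "rm (t y (Suc m)) d - rm (t y' (Suc m)) d =
      q m *\<^sub>R (((if y m then 1 else 0) - (if y' m then 1 else 0)) *\<^sub>R rm (lab y) d)"
    by (simp only: linear_diff[OF linear_rm_left, symmetric] linear_scale[OF linear_rm_left, symmetric])
  then show ?thesis
    unfolding gg_telescope[of y d "Suc m"] gg_telescope[of y' d "Suc m"]
    by (simp add: prod_eq_iff scaleR_diff_right del: fact_Suc)
qed

lemma lookup_t_fresh:
  assumes "x \<notin> ky (lab y)" "length x < m"
  shows "lk (t y m) x = (if node y (length x) = x then q (length x) *\<^sub>R e else 0)"
proof -
  have "lk (t y m) x = (\<Sum>i<m. if i = length x then (if node y (length x) = x then q (length x) *\<^sub>R e else 0) else 0)"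
    unfolding t_def lookup_sum using assms(1)
    by (intro sum.cong) (auto simp: el_def lookup_add lookup_single when_def in_keys_iff)
  then show ?thesis using assms(2) by simp
qed

text \<open>Outside the label, a node can occur only in the term of its own level. The lemma is used
  at the first node after two branches have parted.\<close>

lemma theta_gg_diff:
  assumes "x \<notin> ky (lab y)" "lab y' = lab y" "length x < m" "d \<in> A"
  shows "lk (theta m (gg y 0 d - gg y' 0 d)) x =
    q (length x) *\<^sub>R ((if node y (length x) = x then d else 0) - (if node y' (length x) = x then d else 0))"
  using assms
  by (auto simp: theta_def gg_0 linear_diff[OF linear_T] T_single lookup_minus lookup_t_fresh
    linear_scale[OF linear_mul_left] mul_e_left)

text \<open>Vectors of \<open>A\<close> have integer coordinates, so a nonzero coordinate of
  \<open>d\<close> bounds the possible divisors.\<close>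

lemma not_infinitely_divisible:
  assumes "d \<in> A" "d \<noteq> 0"
  shows "\<forall>\<^sub>F m in sequentially. \<not> (\<exists>w\<in>A. d = real m *\<^sub>R w)"
proof -
  obtain s where s: "lk d s \<noteq> 0"
    using assms(2) by (metis lookup_zero poly_mapping_eqI)
  have "\<not> (\<exists>w\<in>A. d = real m *\<^sub>R w)" if m: "real m > \<bar>lk d s\<bar>" for m
  proof
    assume "\<exists>w\<in>A. d = real m *\<^sub>R w"
    then obtain w where w: "w \<in> A" "d = real m *\<^sub>R w" by blast
    then have "lk d s = real m * lk w s" by simp
    moreover from this s have "lk w s \<noteq> 0" by auto
    then have "1 \<le> \<bar>lk w s\<bar>" using A_int[OF w(1)] by (rule Ints_nonzero_abs_ge1[rotated])
    ultimately show False using m mult_left_mono[of 1 "\<bar>lk w s\<bar>" "real m"] by (simp add: abs_mult)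
  qed
  moreover have "\<forall>\<^sub>F m in sequentially. real m > \<bar>lk d s\<bar>"
    using filterlim_real_sequentially by (simp add: filterlim_at_top_dense)
  ultimately show ?thesis by (rule eventually_mono[rotated])
qed

end

locale branch_endomorphism = branch_module A mul e Y lab
  for A :: "'s coef set" and mul e Y lab +
  fixes \<phi> :: "'s vec \<Rightarrow> 's vec"
  assumes \<phi>_in: "u \<in> G \<Longrightarrow> \<phi> u \<in> G"
    and \<phi>_add: "u \<in> G \<Longrightarrow> v \<in> G \<Longrightarrow> \<phi> (u + v) = \<phi> u + \<phi> v"
begin

lemma \<phi>_0: "\<phi> 0 = 0"
  using \<phi>_add[OF G_0 G_0] by simp

lemma \<phi>_minus: "u \<in> G \<Longrightarrow> \<phi> (- u) = - \<phi> u"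
  using \<phi>_add[of u "- u"] G_minus[of u] \<phi>_0 by (simp add: add_eq_0_iff)

lemma \<phi>_diff: "u \<in> G \<Longrightarrow> v \<in> G \<Longrightarrow> \<phi> (u - v) = \<phi> u - \<phi> v"
  using \<phi>_add[of u "- v"] G_minus[of v] \<phi>_minus[of v] by simp

lemma \<phi>_scale:
  assumes u: "u \<in> G" and c: "c \<in> \<int>"
  shows "\<phi> (c *\<^sub>R u) = c *\<^sub>R \<phi> u"
proof -
  have nat: "\<phi> (real j *\<^sub>R u) = real j *\<^sub>R \<phi> u" for j
  proof (induction j)
    case (Suc j)
    have "real j *\<^sub>R u \<in> G" using u by (intro G_scale) auto
    then show ?case using Suc \<phi>_add[of u "real j *\<^sub>R u"] u by (simp add: scaleR_add_left)
  qed (simp add: \<phi>_0)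
  obtain k :: int where k: "c = of_int k" using c by (rule Ints_cases)
  show ?thesis
  proof (cases k rule: int_cases2)
    case (nonneg j)
    then show ?thesis using k nat by simp
  next
    case (nonpos j)
    have "real j *\<^sub>R u \<in> G" using u by (intro G_scale) auto
    then show ?thesis using k nat nonpos \<phi>_minus[of "real j *\<^sub>R u"] by simp
  qed
qed

text \<open>
  The set \<open>K\<close> codes the second components of the images of both \<open>g y\<close> and \<open>g y'\<close>: each of their
  branches is represented by its initial segment of length \<open>L\<close>, its label and its coefficient. The
  difference of these images is divisible by \<open>q m\<close>, which forces the corresponding branches to
  agree below \<open>m\<close>, and those with a label other than \<open>b\<close> to agree also at \<open>m\<close>.
\<close>

lemma split_pair:
  fixes K :: "(bool list \<times> (bool list \<Rightarrow>\<^sub>0 's coef) \<times> 's coef) set"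
  assumes y: "y \<in> Y" "y' \<in> Y" "lab y = b" "lab y' = b"
    and split: "y m" "\<not> y' m" "\<And>k. k < m \<Longrightarrow> y k = y' k"
    and Gk: "\<phi> (gg y 0 e) \<in> Gn k" "\<phi> (gg y' 0 e) \<in> Gn k"
    and fst_eq: "q k *\<^sub>R fst (\<phi> (gg y 0 e)) = q k *\<^sub>R fst (\<phi> (gg y' 0 e))"
    and K: "(\<lambda>z. (node z L, lab z, q k *\<^sub>R lk (snd (\<phi> (gg y 0 e))) z)) ` ky (snd (\<phi> (gg y 0 e))) = K"
      "(\<lambda>z. (node z L, lab z, q k *\<^sub>R lk (snd (\<phi> (gg y' 0 e))) z)) ` ky (snd (\<phi> (gg y' 0 e))) = K"
    and inj: "inj_on (\<lambda>z. node z L) (ky (snd (\<phi> (gg y 0 e))))"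
      "inj_on (\<lambda>z. node z L) (ky (snd (\<phi> (gg y' 0 e))))"
    and fresh: "\<And>p l d x. (p, l, d) \<in> K \<Longrightarrow> L \<le> length x \<Longrightarrow> x \<notin> ky l"
    and indiv: "\<And>p l d. (p, l, d) \<in> K \<Longrightarrow> \<not> (\<exists>w\<in>A. d = real m *\<^sub>R w)"
    and sep: "\<And>p l d z. (p, l, d) \<in> K \<Longrightarrow> l \<noteq> b \<Longrightarrow> z \<in> Y \<Longrightarrow> lab z = l \<Longrightarrow> \<not> z m"
  shows "\<exists>\<epsilon> \<in> K \<rightarrow>\<^sub>E {-1, 0, 1}. \<exists>v\<in>G.
    q k *\<^sub>R \<phi> (b, 0) - (rm b (\<Sum>\<kappa>\<in>K. \<epsilon> \<kappa> *\<^sub>R snd (snd \<kappa>)), 0) = real (Suc m) *\<^sub>R v"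
proof -
  define w where "w = \<phi> (gg y 0 e)"
  define w' where "w' = \<phi> (gg y' 0 e)"
  define code where "code v z = (node z L, lab z, q k *\<^sub>R lk (snd v) z)" for v :: "'s vec" and z
  have bij: "bij_betw (code w) (ky (snd w)) K" "bij_betw (code w') (ky (snd w')) K"
    using K inj unfolding bij_betw_def inj_on_def code_def w_def w'_def by auto
  \<comment> \<open>\<open>a\<close> and \<open>a'\<close> decode \<open>K\<close>: they pair each
    branch of \<open>w\<close> with the branch of \<open>w'\<close> that has the same initial
    segment, label and coefficient.\<close>
  define a where "a = inv_into (ky (snd w)) (code w)"
  define a' where "a' = inv_into (ky (snd w')) (code w')"
  have abij: "bij_betw a K (ky (snd w))" "bij_betw a' K (ky (snd w'))"
    using bij unfolding a_def a'_def by (auto intro: bij_betw_inv_into)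
  have ain: "a \<kappa> \<in> ky (snd w)" "code w (a \<kappa>) = \<kappa>" if "\<kappa> \<in> K" for \<kappa>
    using bij(1) that unfolding a_def bij_betw_def by (auto intro: inv_into_into f_inv_into_f)
  have ain': "a' \<kappa> \<in> ky (snd w')" "code w' (a' \<kappa>) = \<kappa>" if "\<kappa> \<in> K" for \<kappa>
    using bij(2) that unfolding a'_def bij_betw_def by (auto intro: inv_into_into f_inv_into_f)
  have finK: "finite K" using bij(1) bij_betw_finite by fastforce
  define c where "c = \<phi> (b, 0)"
  have bAP: "b \<in> AP" using lab_AP y(3) by blast
  have g_in: "gg y 0 e \<in> G" "gg y' 0 e \<in> G" using y e_in by (auto intro: gg_in)
  have wG: "w \<in> G" "w' \<in> G" "c \<in> G"
    unfolding w_def w'_def c_def using g_in bAP by (auto intro: \<phi>_in)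
  have aY: "a \<kappa> \<in> Y" "a' \<kappa> \<in> Y" if "\<kappa> \<in> K" for \<kappa>
    using ain(1)[OF that] ain'(1)[OF that] G_keys[OF wG(1)] G_keys[OF wG(2)] by blast+
  have components: "node (a \<kappa>) L = fst \<kappa>" "lab (a \<kappa>) = fst (snd \<kappa>)" "q k *\<^sub>R lk (snd w) (a \<kappa>) = snd (snd \<kappa>)"
    "node (a' \<kappa>) L = fst \<kappa>" "lab (a' \<kappa>) = fst (snd \<kappa>)" "q k *\<^sub>R lk (snd w') (a' \<kappa>) = snd (snd \<kappa>)"
    if "\<kappa> \<in> K" for \<kappa>
    using ain(2)[OF that] ain'(2)[OF that] unfolding code_def prod_eq_iff by simp_all
  have dA: "snd (snd \<kappa>) \<in> A" if "\<kappa> \<in> K" for \<kappa>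
    using components(3)[OF that] Gn_numerator(2)[OF Gk(1)] AP_lookup[of "q k *\<^sub>R snd w"] by (metis lookup_scaleR w_def)
  let ?D = "\<Sum>\<kappa>\<in>K. gg (a \<kappa>) 0 (snd (snd \<kappa>)) - gg (a' \<kappa>) 0 (snd (snd \<kappa>))"
  have expand: "q k *\<^sub>R snd v = (\<Sum>\<kappa>\<in>K. sg (f \<kappa>) (snd (snd \<kappa>)))"
    if "bij_betw f K (ky (snd v))" "\<And>\<kappa>. \<kappa> \<in> K \<Longrightarrow> q k *\<^sub>R lk (snd v) (f \<kappa>) = snd (snd \<kappa>)" for v :: "'s vec" and f
  proof -
    have "q k *\<^sub>R snd v = (\<Sum>z\<in>ky (snd v). sg z (q k *\<^sub>R lk (snd v) z))"
      by (subst pm_sum_single) (simp add: scaleR_sum_right scaleR_single)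
    also have "\<dots> = (\<Sum>\<kappa>\<in>K. sg (f \<kappa>) (q k *\<^sub>R lk (snd v) (f \<kappa>)))"
      using that(1) by (rule sum.reindex_bij_betw[symmetric])
    finally show ?thesis using that(2) by simp
  qed
  \<comment> \<open>The scaled first components agree and cancel, so only differences of paired
    branches remain.\<close>
  have D: "q k *\<^sub>R (w - w') = ?D"
  proof (rule prod_eqI)
    show "fst (q k *\<^sub>R (w - w')) = fst ?D"
      using fst_eq by (simp add: fst_sum gg_0 scaleR_diff_right w_def w'_def)
    show "snd (q k *\<^sub>R (w - w')) = snd ?D"
      using expand[OF abij(1) components(3)] expand[OF abij(2) components(6)]
      by (simp add: snd_sum gg_0 scaleR_diff_right sum_subtractf)
  qed
  define v1 where "v1 = gg y (Suc m) e - gg y' (Suc m) e"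
  have v1: "v1 \<in> G" unfolding v1_def using y e_in by (intro G_diff gg_in)
  have "gg y 0 e - gg y' 0 e = q m *\<^sub>R (b, 0) + q (Suc m) *\<^sub>R v1"
    using gg_diff[of y y' m e] split y bAP by (simp add: v1_def rm_e)
  then have "w - w' = \<phi> (q m *\<^sub>R (b, 0) + q (Suc m) *\<^sub>R v1)"
    unfolding w_def w'_def using \<phi>_diff[OF g_in] by simp
  also have "\<dots> = \<phi> (q m *\<^sub>R (b, 0)) + \<phi> (q (Suc m) *\<^sub>R v1)"
    by (intro \<phi>_add G_scale q_Ints v1) (simp add: bAP)
  also have "\<dots> = q m *\<^sub>R c + q (Suc m) *\<^sub>R \<phi> v1"
    using bAP v1 unfolding c_def by (simp only: \<phi>_scale q_Ints G_base)
  finally have "w - w' = q m *\<^sub>R c + q (Suc m) *\<^sub>R \<phi> v1" .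
  then have D1: "?D = q m *\<^sub>R (q k *\<^sub>R (c + real (Suc m) *\<^sub>R \<phi> v1))"
    unfolding D[symmetric] by (simp add: q_Suc scaleR_add_right mult.commute mult.left_commute del: of_nat_Suc fact_Suc)
  let ?U = "q k *\<^sub>R (c + real (Suc m) *\<^sub>R \<phi> v1)"
  have U: "?U \<in> G" using wG v1 by (intro G_scale G_add \<phi>_in) auto
  have DAP: "snd ?D \<in> AP"
    unfolding snd_sum by (intro AP_sum) (simp add: gg_0 AP_diff dA)
  have agree: "a \<kappa> j = a' \<kappa> j" if \<kappa>: "\<kappa> \<in> K" and j: "j < m" for \<kappa> j
  proof (rule ccontr)
    assume ne: "a \<kappa> j \<noteq> a' \<kappa> j"
    define s where "s = (LEAST j. a \<kappa> j \<noteq> a' \<kappa> j)"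
    have s: "a \<kappa> s \<noteq> a' \<kappa> s" unfolding s_def using ne by (rule LeastI)
    have "s \<le> j" unfolding s_def using ne by (rule Least_le)
    then have "s < m" using j by simp
    have below: "a \<kappa> i = a' \<kappa> i" if "i < s" for i
      using not_less_Least[of i "\<lambda>j. a \<kappa> j \<noteq> a' \<kappa> j"] that by (auto simp: s_def)
    have "node (a \<kappa>) L = node (a' \<kappa>) L" using components[OF \<kappa>] by simp
    then have "L \<le> s" using s by (metis node_eq_iff not_le)
    have "even s" using s aY[OF \<kappa>] Y_even by blast
    moreover have "even m" using split(1) y(1) Y_even by blast
    \<comment> \<open>Splitting levels are even, so \<open>s < m\<close> leaves room for the level
      \<open>Suc s\<close> strictly below \<open>m\<close>.\<close>
    ultimately have sm: "Suc s < m" using \<open>s < m\<close> by (metis Suc_lessI even_Suc)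
    \<comment> \<open>The first node of \<open>a \<kappa>\<close> that is no node of
      \<open>a' \<kappa>\<close>. Among all branches involved only \<open>a \<kappa>\<close> passes
      through it, as the segments of length \<open>L\<close> separate the others.\<close>
    define x where "x = node (a \<kappa>) (Suc s)"
    have lx: "length x = Suc s" by (simp add: x_def)
    have freshx: "x \<notin> ky (lab (a \<kappa>'))" if "\<kappa>' \<in> K" for \<kappa>'
      using fresh[of "fst \<kappa>'" "fst (snd \<kappa>')" "snd (snd \<kappa>')" x] that components(2)[OF that] lx \<open>L \<le> s\<close> by simp
    have node_L: "node z L = node (a \<kappa>) L" if "node z (Suc s) = x" for z
      using that \<open>L \<le> s\<close> by (auto simp: x_def node_eq_iff)
    have val: "lk (theta m (gg (a \<kappa>') 0 (snd (snd \<kappa>')) - gg (a' \<kappa>') 0 (snd (snd \<kappa>')))) x =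
        (if \<kappa>' = \<kappa> then q (Suc s) *\<^sub>R snd (snd \<kappa>) else 0)" if \<kappa>': "\<kappa>' \<in> K" for \<kappa>'
    proof -
      have "node (a \<kappa>') (Suc s) = x \<longleftrightarrow> \<kappa>' = \<kappa>"
      proof
        assume "node (a \<kappa>') (Suc s) = x"
        then have "node (a \<kappa>') L = node (a \<kappa>) L" by (rule node_L)
        then have "a \<kappa>' = a \<kappa>"
          using inj(1) ain(1)[OF \<kappa>] ain(1)[OF \<kappa>'] by (auto simp: w_def dest: inj_onD)
        then show "\<kappa>' = \<kappa>" using ain(2)[OF \<kappa>] ain(2)[OF \<kappa>'] by simp
      qed (simp add: x_def)
      moreover have "node (a' \<kappa>') (Suc s) \<noteq> x"
      proof
        assume eq: "node (a' \<kappa>') (Suc s) = x"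
        then have "node (a' \<kappa>') L = node (a' \<kappa>) L"
          using node_L components[OF \<kappa>] by simp
        then have "a' \<kappa>' = a' \<kappa>"
          using inj(2) ain'(1)[OF \<kappa>] ain'(1)[OF \<kappa>'] by (auto simp: w'_def dest: inj_onD)
        then show False using eq s by (auto simp: x_def node_eq_iff)
      qed
      moreover have "lab (a' \<kappa>') = lab (a \<kappa>')" using components[OF \<kappa>'] by simp
      ultimately show ?thesis
        using theta_gg_diff[OF freshx[OF \<kappa>'], of "a' \<kappa>'" m "snd (snd \<kappa>')"] sm dA[OF \<kappa>'] lx by simp
    qed
    have "lk (theta m ?D) x = (\<Sum>\<kappa>'\<in>K. if \<kappa>' = \<kappa> then q (Suc s) *\<^sub>R snd (snd \<kappa>) else 0)"
      unfolding linear_sum[OF linear_theta] lookup_sum by (rule sum.cong[OF refl val])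
    then have "lk (theta m ?D) x = q (Suc s) *\<^sub>R snd (snd \<kappa>)"
      using \<kappa> finK by simp
    moreover have "q m *\<^sub>R snd ?U \<in> AP"
      using DAP unfolding D1 by (simp only: snd_scaleR)
    then obtain W where W: "W \<in> AP" "theta m (q m *\<^sub>R ?U) = q m *\<^sub>R W"
      using theta_divisible[OF U, of m] by blast
    ultimately have eq: "q (Suc s) *\<^sub>R snd (snd \<kappa>) = q m *\<^sub>R lk W x"
      unfolding D1 by (simp only: lookup_scaleR)
    \<comment> \<open>Since \<open>q m\<close> is \<open>m\<close> times \<open>q m'\<close> and
      \<open>q (Suc s)\<close> divides \<open>q m'\<close>, cancelling \<open>q (Suc s)\<close>
      leaves the coefficient divisible by \<open>m\<close>, against \<open>indiv\<close>.\<close>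
    obtain m' where m': "m = Suc m'" "Suc s \<le> m'" using sm by (cases m) auto
    obtain i :: nat where i: "q m' = real i * q (Suc s)" using q_multiple m'(2) by blast
    have "q m = real m * q m'" unfolding m'(1) by (rule q_Suc)
    then have "q m *\<^sub>R lk W x = q (Suc s) *\<^sub>R (real m *\<^sub>R (real i *\<^sub>R lk W x))"
      using i by (simp only: scaleR_scaleR mult.commute mult.left_commute)
    then have "q (Suc s) *\<^sub>R snd (snd \<kappa>) = q (Suc s) *\<^sub>R (real m *\<^sub>R (real i *\<^sub>R lk W x))"
      using eq by (rule trans[rotated])
    then have "snd (snd \<kappa>) = real m *\<^sub>R (real i *\<^sub>R lk W x)"
      by (simp only: scaleR_cancel_left fact_nonzero simp_thms)
    moreover have "real i *\<^sub>R lk W x \<in> A" using W by (intro A_scale AP_lookup) auto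
    moreover have "(fst \<kappa>, fst (snd \<kappa>), snd (snd \<kappa>)) \<in> K" using \<kappa> by simp
    ultimately show False using indiv by blast
  qed
  \<comment> \<open>Records whether, and with which sign, a pair with label \<open>b\<close> splits
    at \<open>m\<close>. For any other label both branches are false at \<open>m\<close> by
    \<open>sep\<close>.\<close>
  define \<epsilon> where "\<epsilon> = (\<lambda>\<kappa>\<in>K. if fst (snd \<kappa>) = b
    then (if a \<kappa> m then 1 else 0) - (if a' \<kappa> m then 1 else 0) else 0 :: real)"
  define V where "V = (\<Sum>\<kappa>\<in>K. gg (a \<kappa>) (Suc m) (snd (snd \<kappa>)) - gg (a' \<kappa>) (Suc m) (snd (snd \<kappa>)))"
  have V: "V \<in> G" unfolding V_def using aY dA by (intro G_sum G_diff gg_in)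
  have "gg (a \<kappa>) 0 (snd (snd \<kappa>)) - gg (a' \<kappa>) 0 (snd (snd \<kappa>)) =
      q m *\<^sub>R (rm b (\<epsilon> \<kappa> *\<^sub>R snd (snd \<kappa>)), 0) +
      q (Suc m) *\<^sub>R (gg (a \<kappa>) (Suc m) (snd (snd \<kappa>)) - gg (a' \<kappa>) (Suc m) (snd (snd \<kappa>)))" if \<kappa>: "\<kappa> \<in> K" for \<kappa>
  proof -
    have "((if a \<kappa> m then 1 else 0) - (if a' \<kappa> m then 1 else 0)) *\<^sub>R rm (lab (a \<kappa>)) (snd (snd \<kappa>)) =
        rm b (\<epsilon> \<kappa> *\<^sub>R snd (snd \<kappa>))"
    proof (cases "fst (snd \<kappa>) = b")
      case True
      then show ?thesis using \<kappa> components[OF \<kappa>] by (simp add: \<epsilon>_def linear_scale[OF linear_rm_right] linear_0[OF linear_rm_right] linear_neg[OF linear_rm_right])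
    next
      case False
      then have "\<not> a \<kappa> m" "\<not> a' \<kappa> m"
        using sep[of "fst \<kappa>" "fst (snd \<kappa>)" "snd (snd \<kappa>)"] \<kappa> aY[OF \<kappa>] components[OF \<kappa>] by auto
      then show ?thesis using False \<kappa> by (simp add: \<epsilon>_def linear_0[OF linear_rm_right])
    qed
    moreover have "lab (a \<kappa>) = lab (a' \<kappa>)" using components[OF \<kappa>] by simp
    ultimately show ?thesis using gg_diff[of "a \<kappa>" "a' \<kappa>" m "snd (snd \<kappa>)"] agree[OF \<kappa>] by simp
  qed
  then have "?D = (\<Sum>\<kappa>\<in>K. q m *\<^sub>R (rm b (\<epsilon> \<kappa> *\<^sub>R snd (snd \<kappa>)), 0) +
      q (Suc m) *\<^sub>R (gg (a \<kappa>) (Suc m) (snd (snd \<kappa>)) - gg (a' \<kappa>) (Suc m) (snd (snd \<kappa>))))"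
    by (intro sum.cong) auto
  also have "\<dots> = q m *\<^sub>R (\<Sum>\<kappa>\<in>K. (rm b (\<epsilon> \<kappa> *\<^sub>R snd (snd \<kappa>)), 0)) + q (Suc m) *\<^sub>R V"
    by (simp only: sum.distrib scaleR_sum_right V_def)
  also have "(\<Sum>\<kappa>\<in>K. (rm b (\<epsilon> \<kappa> *\<^sub>R snd (snd \<kappa>)), 0)) = (rm b (\<Sum>\<kappa>\<in>K. \<epsilon> \<kappa> *\<^sub>R snd (snd \<kappa>)), 0 :: (nat \<Rightarrow> bool) \<Rightarrow>\<^sub>0 's coef)"
    by (rule prod_eqI) (simp_all add: fst_sum snd_sum linear_sum[OF linear_rm_right])
  finally have "q m *\<^sub>R ?U = q m *\<^sub>R ((rm b (\<Sum>\<kappa>\<in>K. \<epsilon> \<kappa> *\<^sub>R snd (snd \<kappa>)), 0) + real (Suc m) *\<^sub>R V)"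
    unfolding D1 by (simp only: q_Suc scaleR_add_right scaleR_scaleR mult.commute)
  then have "?U = (rm b (\<Sum>\<kappa>\<in>K. \<epsilon> \<kappa> *\<^sub>R snd (snd \<kappa>)), 0) + real (Suc m) *\<^sub>R V"
    by (simp only: scaleR_cancel_left fact_nonzero simp_thms)
  then have "q k *\<^sub>R c - (rm b (\<Sum>\<kappa>\<in>K. \<epsilon> \<kappa> *\<^sub>R snd (snd \<kappa>)), 0) = real (Suc m) *\<^sub>R (V - q k *\<^sub>R \<phi> v1)"
    by (simp add: algebra_simps del: of_nat_Suc)
  moreover have "V - q k *\<^sub>R \<phi> v1 \<in> G" using V v1 by (intro G_diff G_scale \<phi>_in) auto
  moreover have "\<epsilon> \<in> K \<rightarrow>\<^sub>E {-1, 0, 1}" by (auto simp: \<epsilon>_def)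
  ultimately show ?thesis unfolding c_def by blast
qed

end

section \<open>From congruences to scalars\<close>

context branch_endomorphism
begin

text \<open>The images of the branch elements with label \<open>b\<close> have at most
  \<open>|A|\<close> codes, so infinitely many of these branches share one. Pairs among them split
  at arbitrarily large \<open>m\<close>, and \<open>split_pair\<close> yields an element divisible
  by \<open>m + 1\<close>; \<open>divisible_zero\<close> then applies.\<close>

lemma base_image:
  assumes b: "b \<in> AP" and large: "|A| <o |{y \<in> Y. lab y = b}|"
  shows "\<exists>k. \<exists>d\<in>A. q k *\<^sub>R \<phi> (b, 0) = (rm b d, 0)"
proof -
  define X where "X = {y \<in> Y. lab y = b}"
  define w where "w y = \<phi> (gg y 0 e)" for y
  have wG: "w y \<in> G" if "y \<in> X" for y
    unfolding w_def using that e_in by (intro \<phi>_in gg_in) (auto simp: X_def)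
  then have "\<forall>y. \<exists>k. y \<in> X \<longrightarrow> w y \<in> Gn k" by (auto simp: G_def)
  then obtain k where k: "\<And>y. y \<in> X \<Longrightarrow> w y \<in> Gn (k y)" by metis
  \<comment> \<open>The length \<open>L\<close> separates the branches of the image and exceeds all
    nodes in their labels.\<close>
  have "\<exists>L. inj_on (\<lambda>z. node z L) (ky (snd (w y))) \<and> (\<forall>z\<in>ky (snd (w y)). \<forall>x\<in>ky (lab z). length x < L)" for y
  proof -
    have "\<forall>\<^sub>F L in sequentially. z \<noteq> z' \<longrightarrow> node z L \<noteq> node z' L" for z z'
    proof (cases "z = z'")
      case False
      then obtain j where j: "z j \<noteq> z' j" by blast
      have "\<forall>\<^sub>F L in sequentially. node z L \<noteq> node z' L"
        using eventually_gt_at_top[of j]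
      proof eventually_elim
        case (elim L)
        then show ?case using j by (auto simp: node_eq_iff)
      qed
      then show ?thesis by (rule eventually_mono) simp
    qed simp
    then have "\<forall>\<^sub>F L in sequentially. \<forall>z\<in>ky (snd (w y)). \<forall>z'\<in>ky (snd (w y)). z \<noteq> z' \<longrightarrow> node z L \<noteq> node z' L"
      by (intro eventually_ball_finite ballI finite_keys)
    moreover have "\<forall>\<^sub>F L in sequentially. \<forall>z\<in>ky (snd (w y)). \<forall>x\<in>ky (lab z). length x < L"
      by (intro eventually_ball_finite ballI finite_keys eventually_gt_at_top)
    ultimately have "\<forall>\<^sub>F L in sequentially. (\<forall>z\<in>ky (snd (w y)). \<forall>z'\<in>ky (snd (w y)). z \<noteq> z' \<longrightarrow> node z L \<noteq> node z' L) \<and>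
        (\<forall>z\<in>ky (snd (w y)). \<forall>x\<in>ky (lab z). length x < L)"
      by (rule eventually_conj)
    then show ?thesis
      by (auto simp: eventually_sequentially inj_on_def) (metis order_refl)
  qed
  then obtain L where L: "\<And>y. inj_on (\<lambda>z. node z (L y)) (ky (snd (w y)))"
    "\<And>y z x. z \<in> ky (snd (w y)) \<Longrightarrow> x \<in> ky (lab z) \<Longrightarrow> length x < L y" by metis
  \<comment> \<open>Branches enter the code only through their initial segments and labels; this
    keeps the number of codes at most \<open>|A|\<close>, although \<open>Y\<close> is
    larger.\<close>
  define code where "code y = (k y, q (k y) *\<^sub>R fst (w y), L y,
    (\<lambda>z. (node z (L y), lab z, q (k y) *\<^sub>R lk (snd (w y)) z)) ` ky (snd (w y)))" for y
  let ?D = "(UNIV :: nat set) \<times> (AP :: (bool list \<Rightarrow>\<^sub>0 's coef) set) \<times> (UNIV :: nat set) \<times>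
    Fpow ((UNIV :: bool list set) \<times> (AP :: (bool list \<Rightarrow>\<^sub>0 's coef) set) \<times> A)"
  have "|?D| \<le>o |A|"
    by (intro Times_ordLeq_infinite Fpow_ordLeq_infinite infinite_A AP_ordLeq countable_ordLeq_infinite countableI_type
      ordLeq_refl card_of_Card_order)
  moreover have "code ` X \<subseteq> ?D"
  proof
    fix d assume "d \<in> code ` X"
    then obtain y where y: "y \<in> X" "d = code y" by blast
    have "q (k y) *\<^sub>R lk (snd (w y)) z \<in> A" for z
      using AP_lookup[OF Gn_numerator(2)[OF k[OF y(1)]], of z] by simp
    then show "d \<in> ?D"
      unfolding y(2) code_def using Gn_numerator(1)[OF k[OF y(1)]] by (auto simp: Fpow_def lab_AP)
  qed
  ultimately obtain d where d: "d \<in> ?D" and inf: "infinite {y \<in> X. code y = d}"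
    using infinite_fibre[OF infinite_A _ large[folded X_def]] by blast
  define F where "F = {y \<in> X. code y = d}"
  obtain k0 c0 L0 K where dd: "d = (k0, c0, L0, K)" by (metis prod_cases4)
  have K: "finite K" "K \<subseteq> UNIV \<times> AP \<times> A" using d unfolding dd Fpow_def by auto
  have F: "k y = k0" "q k0 *\<^sub>R fst (w y) = c0" "L y = L0"
    "(\<lambda>z. (node z L0, lab z, q k0 *\<^sub>R lk (snd (w y)) z)) ` ky (snd (w y)) = K" "y \<in> X" if "y \<in> F" for y
    using that unfolding F_def dd code_def by auto
  obtain y0 where y0: "y0 \<in> F" using inf F_def by (metis ex_in_conv finite.emptyI)
  have K_nonzero: "r \<noteq> 0" if "(p, l, r) \<in> K" for p l r
    using that unfolding F(4)[OF y0, symmetric] by (auto simp: in_keys_iff)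
  have K_fresh: "x \<notin> ky l" if "(p, l, r) \<in> K" "L0 \<le> length x" for p l r x
    using that L(2)[of _ y0 x] F(3)[OF y0] unfolding F(4)[OF y0, symmetric] by force
  have K_lab: "l \<in> AP" "r \<in> A" if "(p, l, r) \<in> K" for p l r using that K(2) by auto
  have "\<forall>\<^sub>F m in sequentially. \<forall>\<kappa>\<in>K. \<not> (\<exists>v\<in>A. snd (snd \<kappa>) = real m *\<^sub>R v)"
    using K_lab K_nonzero by (intro eventually_ball_finite K(1) ballI not_infinitely_divisible) (metis prod.collapse)+
  moreover have "\<forall>\<^sub>F m in sequentially. \<forall>\<kappa>\<in>K. fst (snd \<kappa>) \<noteq> b \<longrightarrow>
      (\<forall>y\<in>Y. \<forall>y'\<in>Y. lab y = b \<longrightarrow> lab y' = fst (snd \<kappa>) \<longrightarrow> \<not> (y m \<and> y' m))"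
  proof (intro eventually_ball_finite K(1) ballI)
    fix \<kappa> assume "\<kappa> \<in> K"
    then have "fst (snd \<kappa>) \<in> AP" using K_lab by (metis prod.collapse)
    then show "\<forall>\<^sub>F m in sequentially. fst (snd \<kappa>) \<noteq> b \<longrightarrow>
      (\<forall>y\<in>Y. \<forall>y'\<in>Y. lab y = b \<longrightarrow> lab y' = fst (snd \<kappa>) \<longrightarrow> \<not> (y m \<and> y' m))"
      using Y_separated[OF b, of "fst (snd \<kappa>)"] by (cases "fst (snd \<kappa>) = b") (auto simp: eventually_sequentially)
  qed
  ultimately have "\<forall>\<^sub>F m in sequentially. (\<forall>\<kappa>\<in>K. \<not> (\<exists>v\<in>A. snd (snd \<kappa>) = real m *\<^sub>R v)) \<and>
    (\<forall>\<kappa>\<in>K. fst (snd \<kappa>) \<noteq> b \<longrightarrow>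
      (\<forall>y\<in>Y. \<forall>y'\<in>Y. lab y = b \<longrightarrow> lab y' = fst (snd \<kappa>) \<longrightarrow> \<not> (y m \<and> y' m)))"
    by (rule eventually_conj)
  then obtain M0 where M0: "\<And>m \<kappa>. M0 \<le> m \<Longrightarrow> \<kappa> \<in> K \<Longrightarrow> \<not> (\<exists>v\<in>A. snd (snd \<kappa>) = real m *\<^sub>R v)"
    "\<And>m \<kappa> y y'. M0 \<le> m \<Longrightarrow> \<kappa> \<in> K \<Longrightarrow> fst (snd \<kappa>) \<noteq> b \<Longrightarrow> y \<in> Y \<Longrightarrow> y' \<in> Y \<Longrightarrow> lab y = b \<Longrightarrow>
      lab y' = fst (snd \<kappa>) \<Longrightarrow> \<not> (y m \<and> y' m)"
    unfolding eventually_sequentially by blast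
  let ?d = "\<lambda>\<epsilon>. \<Sum>\<kappa>\<in>K. \<epsilon> \<kappa> *\<^sub>R snd (snd \<kappa>)"
  let ?z = "\<lambda>\<epsilon>. q k0 *\<^sub>R \<phi> (b, 0) - (rm b (?d \<epsilon>), 0)"
  let ?R = "\<lambda>m \<epsilon>. \<exists>v\<in>G. ?z \<epsilon> = real (Suc m) *\<^sub>R v"
  have step: "\<exists>m\<ge>M. \<exists>\<epsilon> \<in> K \<rightarrow>\<^sub>E {-1, 0, 1}. ?R m \<epsilon>" for M
  proof -
    obtain m y y' where m: "max M M0 \<le> m" "y \<in> F" "y' \<in> F" "y m" "\<not> y' m" "\<forall>k<m. y k = y' k"
      using infinite_branches_split[OF inf, folded F_def] by blast
    have yX: "y \<in> Y" "y' \<in> Y" "lab y = b" "lab y' = b"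
      using F(5)[OF m(2)] F(5)[OF m(3)] by (auto simp: X_def)
    have "\<exists>\<epsilon> \<in> K \<rightarrow>\<^sub>E {-1, 0, 1}. ?R m \<epsilon>"
    proof (rule split_pair[where y = y and y' = y' and L = L0])
      show "y \<in> Y" "y' \<in> Y" "lab y = b" "lab y' = b" "y m" "\<not> y' m" by fact+
      show "y k = y' k" if "k < m" for k using m(6) that by blast
      show "\<phi> (gg y 0 e) \<in> Gn k0" "\<phi> (gg y' 0 e) \<in> Gn k0"
        using k[OF F(5)[OF m(2)]] k[OF F(5)[OF m(3)]] F(1)[OF m(2)] F(1)[OF m(3)] by (simp_all add: w_def)
      show "q k0 *\<^sub>R fst (\<phi> (gg y 0 e)) = q k0 *\<^sub>R fst (\<phi> (gg y' 0 e))"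
        using F(2)[OF m(2)] F(2)[OF m(3)] by (simp add: w_def)
      show "(\<lambda>z. (node z L0, lab z, q k0 *\<^sub>R lk (snd (\<phi> (gg y 0 e))) z)) ` ky (snd (\<phi> (gg y 0 e))) = K"
        using F(4)[OF m(2)] by (simp add: w_def)
      show "(\<lambda>z. (node z L0, lab z, q k0 *\<^sub>R lk (snd (\<phi> (gg y' 0 e))) z)) ` ky (snd (\<phi> (gg y' 0 e))) = K"
        using F(4)[OF m(3)] by (simp add: w_def)
      show "inj_on (\<lambda>z. node z L0) (ky (snd (\<phi> (gg y 0 e))))"
        using L(1)[of y] F(3)[OF m(2)] by (simp add: w_def)
      show "inj_on (\<lambda>z. node z L0) (ky (snd (\<phi> (gg y' 0 e))))"
        using L(1)[of y'] F(3)[OF m(3)] by (simp add: w_def)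
      show "x \<notin> ky l" if "(p, l, r) \<in> K" "L0 \<le> length x" for p l r x
        using that by (rule K_fresh)
      show "\<not> (\<exists>v\<in>A. r = real m *\<^sub>R v)" if "(p, l, r) \<in> K" for p l r
        using M0(1)[of m "(p, l, r)"] m(1) that by simp
      show "\<not> z m" if "(p, l, r) \<in> K" "l \<noteq> b" "z \<in> Y" "lab z = l" for p l r z
        using M0(2)[of m "(p, l, r)" y z] m(1,4) yX that by simp
    qed
    then show ?thesis using m(1) by auto
  qed
  \<comment> \<open>The signs depend on \<open>m\<close> but range over a finite set, so one choice
    serves infinitely many \<open>m\<close>.\<close>
  define I where "I = {m. \<exists>\<epsilon> \<in> K \<rightarrow>\<^sub>E {-1, 0, 1}. ?R m \<epsilon>}"
  have "infinite I"
    unfolding infinite_nat_iff_unbounded_le I_def using step by blast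
  moreover have "finite (K \<rightarrow>\<^sub>E {-1, 0, 1 :: real})" using K(1) by (intro finite_PiE) auto
  moreover have "\<forall>m\<in>I. \<exists>\<epsilon> \<in> K \<rightarrow>\<^sub>E {-1, 0, 1}. ?R m \<epsilon>" by (simp add: I_def)
  ultimately obtain \<epsilon> where \<epsilon>: "\<epsilon> \<in> K \<rightarrow>\<^sub>E {-1, 0, 1}" "infinite {m \<in> I. ?R m \<epsilon>}"
    using pigeonhole_infinite_rel[of I "K \<rightarrow>\<^sub>E {-1, 0, 1 :: real}" ?R] by blast
  have dA: "?d \<epsilon> \<in> A"
  proof (intro A_sum A_scale)
    fix \<kappa> assume \<kappa>: "\<kappa> \<in> K"
    then show "snd (snd \<kappa>) \<in> A" using K_lab by (metis prod.collapse)
    have "\<epsilon> \<kappa> \<in> {-1, 0, 1}" using \<epsilon>(1) \<kappa> by auto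
    then show "\<epsilon> \<kappa> \<in> \<int>" by auto
  qed
  have "?z \<epsilon> = 0"
  proof (rule divisible_zero)
    show "?z \<epsilon> \<in> G" using b dA by (intro G_diff G_scale \<phi>_in) (auto intro: rm_AP)
    show "infinite (Suc ` {m \<in> I. ?R m \<epsilon>})" using \<epsilon>(2) by (simp add: finite_image_iff)
    show "\<exists>v\<in>G. ?z \<epsilon> = real m *\<^sub>R v" if "m \<in> Suc ` {m \<in> I. ?R m \<epsilon>}" for m using that by blast
  qed
  then show ?thesis using dA by auto
qed

text \<open>By \<open>base_image\<close> each element of \<open>AP\<close> has a scalar of its own,
  up to a factorial. Mixing two nodes makes these scalars agree, and divisibility carries the result
  from nodes to branches.\<close>

lemma endomorphism_is_scalar:
  assumes large: "\<And>b. b \<in> AP \<Longrightarrow> |A| <o |{y \<in> Y. lab y = b}|"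
  shows "\<exists>r\<in>A. \<forall>u\<in>G. \<phi> u = act u r"
proof -
  have single: "\<exists>r\<in>A. \<phi> (sg x s, 0) = (sg x r, 0)" if s: "s \<in> A" for x s
  proof -
    have "sg x s \<in> AP" using s by simp
    then obtain k d where d: "d \<in> A" "q k *\<^sub>R \<phi> (sg x s, 0) = (rm (sg x s) d, 0)"
      using base_image[OF _ large] by blast
    have "\<phi> (sg x s, 0) = (1 / q k) *\<^sub>R (q k *\<^sub>R \<phi> (sg x s, 0))" by simp
    also have "\<dots> = (sg x ((1 / q k) *\<^sub>R mul s d), 0)"
      unfolding d(2) by (simp add: rm_single scaleR_single)
    finally have eq: "\<phi> (sg x s, 0) = (sg x ((1 / q k) *\<^sub>R mul s d), 0)" .
    moreover have "\<phi> (sg x s, 0) \<in> G" using s by (intro \<phi>_in) simp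
    ultimately show ?thesis by auto
  qed
  define f where "f x s = (SOME r. r \<in> A \<and> \<phi> (sg x s, 0) = (sg x r, 0))" for x s
  have f: "f x s \<in> A" "\<phi> (sg x s, 0) = (sg x (f x s), 0)" if "s \<in> A" for x s
    using someI_ex[of "\<lambda>r. r \<in> A \<and> \<phi> (sg x s, 0) = (sg x r, 0)"] single[OF that, of x]
    unfolding f_def by blast+
  have f_mul: "f x' s = mul s (f x e)" if "x \<noteq> x'" and s: "s \<in> A" for x x' s
  proof -
    have "sg x e + sg x' s \<in> AP" using s e_in by (intro AP_add) auto
    then obtain k d where d: "d \<in> A" "q k *\<^sub>R \<phi> (sg x e + sg x' s, 0) = (rm (sg x e + sg x' s) d, 0)"
      using base_image[OF _ large] by blast
    have "\<phi> (sg x e + sg x' s, 0) = \<phi> ((sg x e, 0) + (sg x' s, 0))" by simp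
    also have "\<dots> = \<phi> (sg x e, 0) + \<phi> (sg x' s, 0)"
      using s e_in by (intro \<phi>_add) simp_all
    also have "\<dots> = (sg x (f x e) + sg x' (f x' s), 0)"
      using f(2) s e_in by simp
    finally have eq: "q k *\<^sub>R (sg x (f x e) + sg x' (f x' s)) = sg x (mul e d) + sg x' (mul s d)"
      using d(2) by (simp add: linear_add[OF linear_rm_left] rm_single)
    have "q k *\<^sub>R f x e = d"
      using arg_cong[OF eq, of "\<lambda>p. lk p x"] \<open>x \<noteq> x'\<close> d(1) by (simp add: lookup_add lookup_single mul_e_left)
    moreover have "q k *\<^sub>R f x' s = mul s d"
      using arg_cong[OF eq, of "\<lambda>p. lk p x'"] \<open>x \<noteq> x'\<close> by (simp add: lookup_add lookup_single)
    ultimately have "q k *\<^sub>R f x' s = q k *\<^sub>R mul s (f x e)"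
      by (metis linear_mul_right linear_scale)
    then show ?thesis by simp
  qed
  define r where "r = f [] e"
  have r: "r \<in> A" unfolding r_def using f(1) e_in by blast
  have f_r: "f x s = mul s r" if s: "s \<in> A" for x s
  proof (cases "x = []")
    case True
    have "f [True] e = r"
      using f_mul[of "[]" "[True]" e] e_in r by (simp add: r_def[symmetric] mul_e_left)
    then show ?thesis using f_mul[of "[True]" "[]" s] s True by simp
  next
    case False
    then show ?thesis using f_mul[of "[]" x s] s by (simp add: r_def)
  qed
  define S where "S = {u \<in> G. \<phi> u = act u r}"
  have S_sub: "add_subgroup S"
    unfolding add_subgroup_def S_def
    by (auto simp: G_0 \<phi>_0 G_diff \<phi>_diff linear_0[OF linear_act_left] linear_diff[OF linear_act_left])
  have base: "(b, 0) \<in> S" if "b \<in> AP" for b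
  proof (rule base_in_subgroup[OF S_sub that])
    fix x a assume a: "a \<in> A"
    have "\<phi> (sg x a, 0) = (sg x (mul a r), 0)" using f(2)[OF a] f_r[OF a] by simp
    moreover have "act (sg x a, 0) r = (sg x (mul a r), 0)"
      by (simp add: act_def rm_single linear_0[OF linear_rm_left])
    ultimately show "(sg x a, 0) \<in> S" using a by (simp add: S_def)
  qed
  have branch: "gg y 0 a \<in> S" if y: "y \<in> Y" and a: "a \<in> A" for y a
  proof -
    let ?\<delta> = "\<lambda>m. \<phi> (gg y m a) - act (gg y m a) r"
    have in_G: "?\<delta> m \<in> G" for m using y a r by (intro G_diff \<phi>_in act_in gg_in)
    have div: "?\<delta> 0 = q m *\<^sub>R ?\<delta> m" for m
    proof -
      have b: "(rm (t y m) a, 0) \<in> S" using a t_AP by (intro base rm_AP)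
      have g: "q m *\<^sub>R gg y m a \<in> G" using y a by (intro G_scale gg_in) auto
      have "\<phi> (gg y 0 a) = \<phi> (rm (t y m) a, 0) + q m *\<^sub>R \<phi> (gg y m a)"
        unfolding gg_telescope[of y a m] using b g y a
        by (subst \<phi>_add) (auto simp: S_def \<phi>_scale gg_in)
      moreover have "act (gg y 0 a) r = act (rm (t y m) a, 0) r + q m *\<^sub>R act (gg y m a) r"
        unfolding gg_telescope[of y a m]
        by (simp only: linear_add[OF linear_act_left] linear_scale[OF linear_act_left])
      ultimately show ?thesis using b by (simp add: S_def scaleR_diff_right)
    qed
    have "?\<delta> 0 = 0"
    proof (rule divisible_zero[OF in_G])
      show "infinite (range (fact :: nat \<Rightarrow> nat))"
        unfolding infinite_nat_iff_unbounded_le by (metis fact_ge_self rangeI)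
      show "\<exists>v\<in>G. ?\<delta> 0 = real m *\<^sub>R v" if m: "m \<in> range fact" for m
      proof -
        obtain j where "m = fact j" using m by blast
        then show ?thesis using div[of j] in_G[of j] by auto
      qed
    qed
    then show ?thesis using y a by (simp add: S_def gg_in)
  qed
  have "\<phi> u = act u r" if u: "u \<in> G" for u
  proof -
    obtain m where m: "u \<in> Gn m" using u by (auto simp: G_def)
    have lkA: "q m *\<^sub>R lk (snd u) y \<in> A" for y
      using AP_lookup[OF Gn_numerator(2)[OF m], of y] by simp
    have "q m *\<^sub>R u = (q m *\<^sub>R fst u, 0) + (\<Sum>y\<in>ky (snd u). gg y 0 (q m *\<^sub>R lk (snd u) y))"
    proof (rule prod_eqI)
      have "snd u = (\<Sum>y\<in>ky (snd u). sg y (lk (snd u) y))" by (rule pm_sum_single)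
      then have "q m *\<^sub>R snd u = q m *\<^sub>R (\<Sum>y\<in>ky (snd u). sg y (lk (snd u) y))" by simp
      then show "snd (q m *\<^sub>R u) = snd ((q m *\<^sub>R fst u, 0) + (\<Sum>y\<in>ky (snd u). gg y 0 (q m *\<^sub>R lk (snd u) y)))"
        by (simp add: snd_sum gg_0 scaleR_sum_right scaleR_single)
    qed (simp add: fst_sum gg_0)
    also have "\<dots> \<in> S"
      using m lkA G_keys[OF u]
      by (intro add_subgroup_add[OF S_sub] add_subgroup_sum[OF S_sub] base branch Gn_numerator) auto
    finally have "q m *\<^sub>R \<phi> u = q m *\<^sub>R act u r"
      using u by (simp add: S_def \<phi>_scale linear_scale[OF linear_act_left])
    then show ?thesis by simp
  qed
  then show ?thesis using r by blast
qed

end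

section \<open>Transport to the given type\<close>

lemma (in coefficient_ring) exists_branch_module:
  fixes U :: "(nat \<Rightarrow> bool) set"
  assumes U: "|A| <o |U|"
  shows "\<exists>Y lab. branch_module A mul e Y lab \<and> (\<forall>b\<in>AP. |A| <o |{y \<in> Y. lab y = b}| ) \<and>
    |Y| \<le>o |U| \<and> |U| \<le>o |Y|"
proof -
  have AU: "|A| \<le>o |U|" using U by (rule ordLess_imp_ordLeq)
  have APU: "|AP :: (bool list \<Rightarrow>\<^sub>0 's coef) set| \<le>o |U|"
    by (rule ordLeq_transitive[OF AP_ordLeq AU])
  then have "|AP :: (bool list \<Rightarrow>\<^sub>0 's coef) set| \<le>o |UNIV :: (nat \<Rightarrow> bool) set|"
    by (rule ordLeq_transitive) (simp add: card_of_mono1)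
  from labelled_branches[OF this, of U]
  obtain Y :: "(nat \<Rightarrow> bool) set" and lab where
    Y: "\<forall>y\<in>Y. lab y \<in> (AP :: (bool list \<Rightarrow>\<^sub>0 's coef) set) \<and> (\<forall>i. y i \<longrightarrow> even i)" and
    large: "\<forall>b\<in>AP. |U| \<le>o |{y \<in> Y. lab y = b}|" and
    small: "|Y| \<le>o |(AP :: (bool list \<Rightarrow>\<^sub>0 's coef) set) \<times> U|" and
    sep: "\<forall>b\<in>AP. \<forall>b'\<in>AP. b \<noteq> b' \<longrightarrow>
      (\<exists>M. \<forall>m\<ge>M. \<forall>y\<in>Y. \<forall>y'\<in>Y. lab y = b \<longrightarrow> lab y' = b' \<longrightarrow> \<not> (y m \<and> y' m))"
    by (elim exE conjE) (rule that)
  define lab' where "lab' y = (if y \<in> Y then lab y else 0)" for y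
  have inf: "infinite U" using infinite_A card_of_ordLeq_infinite[OF AU] by blast
  have fibre: "{y \<in> Y. lab' y = b} = {y \<in> Y. lab y = b}" for b by (auto simp: lab'_def)
  show ?thesis
  proof (intro exI conjI ballI)
    show "branch_module A mul e Y lab'"
    proof unfold_locales
      show "lab' y \<in> AP" for y using Y by (simp add: lab'_def AP_0)
      show "even i" if "y \<in> Y" "y i" for y i using Y that by blast
      show "\<exists>M. \<forall>m\<ge>M. \<forall>y\<in>Y. \<forall>y'\<in>Y. lab' y = b \<longrightarrow> lab' y' = b' \<longrightarrow> \<not> (y m \<and> y' m)"
        if "b \<in> AP" "b' \<in> AP" "b \<noteq> b'" for b b'
        using sep that by (simp add: lab'_def)
    qed
    show "|A| <o |{y \<in> Y. lab' y = b}|" if "b \<in> AP" for b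
      unfolding fibre using U large[rule_format, OF that] by (rule ordLess_ordLeq_trans)
    show "|Y| \<le>o |U|"
      using small Times_ordLeq_infinite[OF inf APU ordLeq_refl[OF card_of_Card_order]] by (rule ordLeq_transitive)
    show "|U| \<le>o |Y|"
      using large[rule_format, OF AP_0] by (rule ordLeq_transitive) (auto intro: card_of_mono1)
  qed
qed

lemma (in branch_module) card_G:
  assumes U: "|A| \<le>o |U|" "|Y| \<le>o |U|" "|U| \<le>o |Y|"
  shows "|G| =o |U|"
proof -
  have inf: "infinite U" using infinite_A card_of_ordLeq_infinite[OF U(1)] by blast
  have "|U| \<le>o |G|"
  proof (rule ordLeq_transitive[OF U(3)], rule card_of_ordLeqI)
    show "inj_on (\<lambda>y. gg y 0 e) Y"
      using e_nonzero by (auto simp: inj_on_def gg_0 poly_mapping_eq_iff fun_eq_iff lookup_single when_def)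
    show "gg y 0 e \<in> G" if "y \<in> Y" for y using that e_in by (rule gg_in)
  qed
  moreover have "|G| \<le>o |U|"
  proof -
    let ?Q = "{p :: (nat \<Rightarrow> bool) \<Rightarrow>\<^sub>0 's coef. ky p \<subseteq> Y \<and> (\<forall>k. lk p k \<in> A)}"
    let ?P = "{p :: bool list \<Rightarrow>\<^sub>0 's coef. ky p \<subseteq> UNIV \<and> (\<forall>k. lk p k \<in> A)}"
    let ?f = "\<lambda>(m, p, d). ((1 / q m) *\<^sub>R p, (1 / q m) *\<^sub>R d)"
    have "G \<subseteq> ?f ` ((UNIV :: nat set) \<times> ?P \<times> ?Q)"
    proof
      fix u assume "u \<in> G"
      then obtain m where m: "u \<in> Gn m" by (auto simp: G_def)
      have "ky (q m *\<^sub>R snd u) \<subseteq> Y" using m by (simp add: keys_scaleR Gn_def)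
      then have "(m, q m *\<^sub>R fst u, q m *\<^sub>R snd u) \<in> UNIV \<times> ?P \<times> ?Q"
        using Gn_numerator[OF m] by (auto simp: AP_def)
      moreover have "u = ?f (m, q m *\<^sub>R fst u, q m *\<^sub>R snd u)" by (simp add: prod_eq_iff)
      ultimately show "u \<in> ?f ` ((UNIV :: nat set) \<times> ?P \<times> ?Q)" by (rule rev_image_eqI)
    qed
    then have "|G| \<le>o |(UNIV :: nat set) \<times> ?P \<times> ?Q|" by (rule surj_imp_ordLeq)
    also have "|(UNIV :: nat set) \<times> ?P \<times> ?Q| \<le>o |U|"
      by (intro Times_ordLeq_infinite inf poly_mapping_ordLeq_infinite U(1,2)
        countable_ordLeq_infinite countableI_type)
    finally show ?thesis .
  qed
  ultimately show ?thesis by (simp add: ordIso_iff_ordLeq)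
qed

locale transported_group =
  fixes G0 :: "'v::ab_group_add set" and \<sigma> :: "'v \<Rightarrow> 'l" and C :: "'l set"
  assumes sub: "add_subgroup G0" and bij: "bij_betw \<sigma> G0 C"
begin

definition \<tau> where "\<tau> = inv_into G0 \<sigma>"

definition Gl :: "'l monoid" where
  "Gl = \<lparr>carrier = C, monoid.mult = (\<lambda>a b. \<sigma> (\<tau> a + \<tau> b)), one = \<sigma> 0\<rparr>"

lemma \<tau>_in [simp]: "g \<in> C \<Longrightarrow> \<tau> g \<in> G0"
  using bij unfolding \<tau>_def bij_betw_def by (auto intro: inv_into_into)

lemma \<sigma>_in [simp]: "u \<in> G0 \<Longrightarrow> \<sigma> u \<in> C"
  using bij by (auto simp: bij_betw_def)

lemma \<sigma>_\<tau> [simp]: "g \<in> C \<Longrightarrow> \<sigma> (\<tau> g) = g"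
  using bij unfolding \<tau>_def bij_betw_def by (auto intro: f_inv_into_f)

lemma \<tau>_\<sigma> [simp]: "u \<in> G0 \<Longrightarrow> \<tau> (\<sigma> u) = u"
  using bij unfolding \<tau>_def bij_betw_def by (auto intro: inv_into_f_f)

lemma Gl_simps [simp]: "carrier Gl = C" "a \<otimes>\<^bsub>Gl\<^esub> b = \<sigma> (\<tau> a + \<tau> b)" "\<one>\<^bsub>Gl\<^esub> = \<sigma> 0"
  by (simp_all add: Gl_def)

lemma G0_closed [simp]: "0 \<in> G0" "u \<in> G0 \<Longrightarrow> v \<in> G0 \<Longrightarrow> u + v \<in> G0" "u \<in> G0 \<Longrightarrow> - u \<in> G0"
  using sub by (auto intro: add_subgroup_0 add_subgroup_add add_subgroup_minus)

lemma comm_group_Gl: "comm_group Gl"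
proof (rule comm_groupI)
  fix x assume "x \<in> carrier Gl"
  then show "\<exists>y\<in>carrier Gl. y \<otimes>\<^bsub>Gl\<^esub> x = \<one>\<^bsub>Gl\<^esub>"
    by (intro bexI[of _ "\<sigma> (- \<tau> x)"]) simp_all
qed (simp_all add: ac_simps)

end

lemma (in branch_module) transported_aleph1_free:
  assumes "bij_betw \<sigma> G C"
  shows "aleph1_free (transported_group.Gl G \<sigma> C)"
proof -
  interpret tr: transported_group G \<sigma> C
    using G_sub assms by unfold_locales
  have grp: "group tr.Gl" using tr.comm_group_Gl by (simp add: comm_group_def)
  show ?thesis
    unfolding aleph1_free_def
  proof (intro conjI allI impI tr.comm_group_Gl; elim conjE)
    fix H assume H: "subgroup H tr.Gl" and cH: "countable H"
    have HC: "g \<in> C" if "g \<in> H" for g using subgroup.subset[OF H] that by auto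
    define Z where "Z = (\<Union>g\<in>H. ky (snd (tr.\<tau> g)))"
    have "countable Z" unfolding Z_def by (rule countable_UN[OF cH]) (simp add: countable_finite)
    then obtain \<psi> :: "'s vec \<Rightarrow> (bool list \<times> 's \<Rightarrow>\<^sub>0 int)" where
      inj: "inj_on \<psi> {u \<in> G. ky (snd u) \<subseteq> Z}" and
      add: "\<forall>u\<in>{u \<in> G. ky (snd u) \<subseteq> Z}. \<forall>v\<in>{u \<in> G. ky (snd u) \<subseteq> Z}. \<psi> (u + v) = \<psi> u + \<psi> v"
      using countable_embedding by blast
    have in_Z: "tr.\<tau> g \<in> {u \<in> G. ky (snd u) \<subseteq> Z}" if "g \<in> H" for g
      using that HC[OF that] by (auto simp: Z_def)
    show "is_free_abelian (tr.Gl\<lparr>carrier := H\<rparr>)"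
    proof (rule is_free_abelian_embed)
      show "group (tr.Gl\<lparr>carrier := H\<rparr>)" using grp H by (rule group.subgroup_imp_group)
      show "(\<lambda>g. \<psi> (tr.\<tau> g)) \<in> hom (tr.Gl\<lparr>carrier := H\<rparr>) (free_Abelian_group UNIV)"
      proof (rule homI)
        fix g h assume gh: "g \<in> carrier (tr.Gl\<lparr>carrier := H\<rparr>)" "h \<in> carrier (tr.Gl\<lparr>carrier := H\<rparr>)"
        have "\<psi> (tr.\<tau> g + tr.\<tau> h) = \<psi> (tr.\<tau> g) + \<psi> (tr.\<tau> h)"
          using add in_Z gh by (metis (no_types, lifting) partial_object.select_convs(1) partial_object.update_convs(1) monoid.surjective)
        then show "\<psi> (tr.\<tau> (g \<otimes>\<^bsub>tr.Gl\<lparr>carrier := H\<rparr>\<^esub> h)) =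
            \<psi> (tr.\<tau> g) \<otimes>\<^bsub>free_Abelian_group UNIV\<^esub> \<psi> (tr.\<tau> h)"
          using gh HC by simp
      qed simp
      show "inj_on (\<lambda>g. \<psi> (tr.\<tau> g)) (carrier (tr.Gl\<lparr>carrier := H\<rparr>))"
      proof (rule inj_onI)
        fix g h assume gh: "g \<in> carrier (tr.Gl\<lparr>carrier := H\<rparr>)" "h \<in> carrier (tr.Gl\<lparr>carrier := H\<rparr>)"
          and eq: "\<psi> (tr.\<tau> g) = \<psi> (tr.\<tau> h)"
        then have "g \<in> H" "h \<in> H" by simp_all
        then have "tr.\<tau> g = tr.\<tau> h" using inj_onD[OF inj eq] in_Z by blast
        then show "g = h" using HC \<open>g \<in> H\<close> \<open>h \<in> H\<close> by (metis tr.\<sigma>_\<tau>)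
      qed
    qed
  qed
qed

section \<open>The ring as integer vectors\<close>

lemma linear_lin_extend_param:
  assumes "\<And>k v. linear (\<lambda>w. F w k v)"
  shows "linear (\<lambda>w. lin_extend (F w) p)"
  unfolding lin_extend_def by (intro linear_compose_sum ballI assms)

locale free_ring = ring R for R :: "'r ring" (structure) +
  fixes S :: "'r set" and h :: "'r \<Rightarrow> 'r \<Rightarrow>\<^sub>0 int"
  assumes h_iso: "h \<in> iso (add_monoid R) (free_Abelian_group S)"
    and one_not_zero: "\<one> \<noteq> \<zero>"
begin

definition \<iota> :: "'r \<Rightarrow> 'r coef" where
  "\<iota> r = Poly_Mapping.map real_of_int (h r)"

definition gen :: "'r \<Rightarrow> 'r" where
  "gen s = inv_into (carrier R) h (frag_of s)"

definition struct_const :: "'r \<Rightarrow> 'r \<Rightarrow> 'r coef" where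
  "struct_const s s' = (if s \<in> S \<and> s' \<in> S then \<iota> (gen s \<otimes> gen s') else 0)"

definition mul :: "'r coef \<Rightarrow> 'r coef \<Rightarrow> 'r coef" where
  "mul w w' = lin_extend (\<lambda>s c. lin_extend (\<lambda>s' c'. (c * c') *\<^sub>R struct_const s s') w') w"

lemma lookup_\<iota>: "lk (\<iota> r) s = real_of_int (lk (h r) s)"
  by (simp add: \<iota>_def lookup_map_zero)

lemma h_bij: "bij_betw h (carrier R) {c. ky c \<subseteq> S}"
  using h_iso by (simp add: iso_def free_Abelian_group_def)

lemma h_add: "a \<in> carrier R \<Longrightarrow> b \<in> carrier R \<Longrightarrow> h (a \<oplus> b) = h a + h b"
  using h_iso by (auto simp: iso_def hom_def)

lemma \<iota>_add: "a \<in> carrier R \<Longrightarrow> b \<in> carrier R \<Longrightarrow> \<iota> (a \<oplus> b) = \<iota> a + \<iota> b"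
  by (rule poly_mapping_eqI) (simp add: lookup_\<iota> h_add lookup_add)

lemma \<iota>_zero: "\<iota> \<zero> = 0"
  using \<iota>_add[of \<zero> \<zero>] by simp

lemma \<iota>_minus: "a \<in> carrier R \<Longrightarrow> \<iota> (\<ominus> a) = - \<iota> a"
  using \<iota>_add[of a "\<ominus> a"] by (simp add: r_neg \<iota>_zero eq_neg_iff_add_eq_0 add.commute)

lemma \<iota>_diff: "a \<in> carrier R \<Longrightarrow> b \<in> carrier R \<Longrightarrow> \<iota> (a \<ominus> b) = \<iota> a - \<iota> b"
  by (simp add: a_minus_def \<iota>_add \<iota>_minus)

lemma \<iota>_inj: "inj_on \<iota> (carrier R)"
proof (rule inj_onI)
  fix a b assume ab: "a \<in> carrier R" "b \<in> carrier R" "\<iota> a = \<iota> b"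
  have "h a = h b"
  proof (rule poly_mapping_eqI)
    fix s
    have "real_of_int (lk (h a) s) = real_of_int (lk (h b) s)" using ab(3) by (simp flip: lookup_\<iota>)
    then show "lk (h a) s = lk (h b) s" by simp
  qed
  then show "a = b" using h_bij ab by (auto simp: bij_betw_def dest: inj_onD)
qed

lemma gen: "s \<in> S \<Longrightarrow> gen s \<in> carrier R" "s \<in> S \<Longrightarrow> h (gen s) = frag_of s"
proof -
  assume "s \<in> S"
  then have "frag_of s \<in> h ` carrier R" using h_bij by (simp add: bij_betw_def keys_frag_of)
  then show "gen s \<in> carrier R" "h (gen s) = frag_of s"
    unfolding gen_def by (auto intro: inv_into_into f_inv_into_f)
qed

lemma \<iota>_gen: "s \<in> S \<Longrightarrow> \<iota> (gen s) = sg s 1"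
  by (rule poly_mapping_eqI) (simp add: lookup_\<iota> gen lookup_single when_def)

lemma ring_induct [consumes 1, case_names zero generator minus]:
  assumes r: "r \<in> carrier R" and zero: "P \<zero>" and gens: "\<And>s. s \<in> S \<Longrightarrow> P (gen s)"
    and diff: "\<And>a b. a \<in> carrier R \<Longrightarrow> b \<in> carrier R \<Longrightarrow> P a \<Longrightarrow> P b \<Longrightarrow> P (a \<ominus> b)"
  shows "P r"
proof -
  have inj: "a = b" if "a \<in> carrier R" "b \<in> carrier R" "h a = h b" for a b
    using h_bij that by (auto simp: bij_betw_def dest: inj_onD)
  have surj: "ky c \<subseteq> S \<Longrightarrow> \<exists>a\<in>carrier R. h a = c \<and> P a" for c
  proof (induction c rule: frag_induction)
    case zero
    have "h \<zero> = 0" using h_add[of \<zero> \<zero>] by simp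
    then show ?case using assms(2) by blast
  next
    case (one s)
    then show ?case using gen gens by blast
  next
    case (diff c d)
    then obtain a b where ab: "a \<in> carrier R" "h a = c" "P a" "b \<in> carrier R" "h b = d" "P b" by blast
    have "h ((a \<ominus> b) \<oplus> b) = h (a \<ominus> b) + h b" using ab by (intro h_add) simp_all
    moreover have "(a \<ominus> b) \<oplus> b = a" using ab by (simp add: a_minus_def a_assoc l_neg)
    ultimately have "h (a \<ominus> b) = c - d" using ab by (simp add: algebra_simps)
    moreover have "P (a \<ominus> b)" using ab by (intro assms(4))
    ultimately show ?case using ab by (intro bexI[of _ "a \<ominus> b"]) simp_all
  qed
  have "h r \<in> {c. ky c \<subseteq> S}" using h_bij r unfolding bij_betw_def by blast
  then obtain a where "a \<in> carrier R" "h a = h r" "P a" using surj[of "h r"] by blast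
  then show ?thesis using inj[of a r] r by simp
qed

lemma linear_inner: "linear (\<lambda>c. lin_extend (\<lambda>s' c'. (c * c') *\<^sub>R struct_const s s') w')"
  by (rule linear_lin_extend_param) (rule linearI; simp add: algebra_simps)

lemma linear_inner_arg: "linear (lin_extend (\<lambda>s' c'. (c * c') *\<^sub>R struct_const s s'))"
  by (rule linear_lin_extend) (rule linearI; simp add: algebra_simps)

lemma linear_mul_left: "linear (\<lambda>w. mul w w')"
  unfolding mul_def by (intro linear_lin_extend linear_inner)

lemma linear_mul_right: "linear (mul w)"
  unfolding mul_def[abs_def] lin_extend_def[of "\<lambda>s c. lin_extend (\<lambda>s' c'. (c * c') *\<^sub>R struct_const s s') _"]
  by (intro linear_compose_sum ballI linear_inner_arg)

lemma mul_single: "mul (sg s x) (sg s' x') = (x * x') *\<^sub>R struct_const s s'"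
proof -
  have "mul (sg s x) (sg s' x') = lin_extend (\<lambda>s' c'. (x * c') *\<^sub>R struct_const s s') (sg s' x')"
    unfolding mul_def by (rule lin_extend_single) (rule linear_inner)
  also have "\<dots> = (x * x') *\<^sub>R struct_const s s'"
    by (rule lin_extend_single) (rule linearI; simp add: algebra_simps)
  finally show ?thesis .
qed

lemma mul_\<iota>:
  assumes "a \<in> carrier R" "b \<in> carrier R"
  shows "mul (\<iota> a) (\<iota> b) = \<iota> (a \<otimes> b)"
  using assms(1)
proof (induction a rule: ring_induct)
  case zero
  then show ?case using assms(2) by (simp add: \<iota>_zero linear_0[OF linear_mul_left])
next
  case (generator s)
  show ?case using assms(2)
  proof (induction b rule: ring_induct)
    case zero
    then show ?case using gen generator by (simp add: \<iota>_zero linear_0[OF linear_mul_right])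
  next
    case (generator s')
    then show ?case using \<open>s \<in> S\<close> by (simp add: \<iota>_gen mul_single struct_const_def)
  next
    case (minus c d)
    have "gen s \<otimes> (c \<ominus> d) = (gen s \<otimes> c) \<ominus> (gen s \<otimes> d)"
      using minus gen \<open>s \<in> S\<close> by (simp add: a_minus_def r_distr r_minus)
    then show ?case using minus gen \<open>s \<in> S\<close> by (simp add: \<iota>_diff linear_diff[OF linear_mul_right])
  qed
next
  case (minus c d)
  have "(c \<ominus> d) \<otimes> b = (c \<otimes> b) \<ominus> (d \<otimes> b)"
    using minus assms(2) by (simp add: a_minus_def l_distr l_minus)
  then show ?case using minus assms(2) by (simp add: \<iota>_diff linear_diff[OF linear_mul_left])
qed

lemma mul_not_in_S:
  assumes "s \<notin> S"
  shows "mul (sg s x) w = 0" "mul w (sg s x) = 0"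
proof -
  have "mul (sg s x) w = (\<lambda>_. 0) w"
    by (rule linear_eq_on_singles[OF linear_mul_right]) (use assms in \<open>simp_all add: mul_single struct_const_def linear_zero\<close>)
  then show "mul (sg s x) w = 0" by simp
  have "(\<lambda>w. mul w (sg s x)) w = (\<lambda>_. 0) w"
    by (rule linear_eq_on_singles[OF linear_mul_left]) (use assms in \<open>simp_all add: mul_single struct_const_def linear_zero\<close>)
  then show "mul w (sg s x) = 0" by simp
qed

lemma mul_assoc_single: "mul (mul (sg s x) (sg s' x')) (sg s'' x'') = mul (sg s x) (mul (sg s' x') (sg s'' x''))"
proof (cases "s \<in> S \<and> s' \<in> S \<and> s'' \<in> S")
  case True
  have sg: "sg z c = c *\<^sub>R \<iota> (gen z)" if "z \<in> S" for z c
    using that by (simp add: \<iota>_gen scaleR_single)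
  have "mul (mul (\<iota> (gen s)) (\<iota> (gen s'))) (\<iota> (gen s'')) = mul (\<iota> (gen s)) (mul (\<iota> (gen s')) (\<iota> (gen s'')))"
    using True by (simp add: mul_\<iota> gen m_assoc)
  then show ?thesis
    using True by (simp add: sg linear_scale[OF linear_mul_left] linear_scale[OF linear_mul_right])
next
  case False
  then show ?thesis
    using mul_not_in_S by (auto simp: linear_0[OF linear_mul_left] linear_0[OF linear_mul_right])
qed

lemma mul_assoc: "mul (mul a b) c = mul a (mul b c)"
proof -
  note lin = linear_mul_left linear_mul_right linear_compose[OF linear_mul_left linear_mul_left, unfolded o_def]
    linear_compose[OF linear_mul_right linear_mul_left, unfolded o_def]
    linear_compose[OF linear_mul_left linear_mul_right, unfolded o_def]
    linear_compose[OF linear_mul_right linear_mul_right, unfolded o_def]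
  have 1: "mul (mul (sg s x) (sg s' x')) c = mul (sg s x) (mul (sg s' x') c)" for s x s' x'
    by (rule linear_eq_on_singles[of "\<lambda>c. mul (mul (sg s x) (sg s' x')) c" "\<lambda>c. mul (sg s x) (mul (sg s' x') c)"])
      (intro lin mul_assoc_single)+
  have 2: "mul (mul (sg s x) b) c = mul (sg s x) (mul b c)" for s x
    by (rule linear_eq_on_singles[of "\<lambda>b. mul (mul (sg s x) b) c" "\<lambda>b. mul (sg s x) (mul b c)"])
      (intro lin 1)+
  show ?thesis
    by (rule linear_eq_on_singles[of "\<lambda>a. mul (mul a b) c" "\<lambda>a. mul a (mul b c)"])
      (intro lin 2)+
qed

lemma coefficient_ring: "coefficient_ring (\<iota> ` carrier R) mul (\<iota> \<one>)"
proof (rule coefficient_ring.intro)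
  show "lk a s \<in> \<int>" if "a \<in> \<iota> ` carrier R" for a s using that by (auto simp: lookup_\<iota>)
  show "add_subgroup (\<iota> ` carrier R)"
    unfolding add_subgroup_def using \<iota>_zero \<iota>_diff by (auto simp flip: \<iota>_diff simp: image_iff intro: zero_closed)
  show "mul a b \<in> \<iota> ` carrier R" if "a \<in> \<iota> ` carrier R" "b \<in> \<iota> ` carrier R" for a b
    using that by (auto simp: mul_\<iota>)
  show "linear (\<lambda>a. mul a b)" for b by (rule linear_mul_left)
  show "linear (mul a)" for a by (rule linear_mul_right)
  show "mul (mul a b) c = mul a (mul b c)" for a b c by (rule mul_assoc)
  show "\<iota> \<one> \<in> \<iota> ` carrier R" by simp
  show "\<iota> \<one> \<noteq> 0" using one_not_zero \<iota>_inj by (metis \<iota>_zero inj_onD one_closed zero_closed)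
  show "mul (\<iota> \<one>) a = a" if "a \<in> \<iota> ` carrier R" for a using that by (auto simp: mul_\<iota>)
  show "mul a (\<iota> \<one>) = a" if "a \<in> \<iota> ` carrier R" for a using that by (auto simp: mul_\<iota>)
qed

lemma card_\<iota>: "|\<iota> ` carrier R| =o |carrier R|"
  using card_of_ordIsoI[OF inj_on_imp_bij_betw[OF \<iota>_inj]] by (rule ordIso_symmetric)

end

lemma ordLeq_continuum_subset:
  assumes "Card_order lam" "lam \<le>o ctwo ^c natLeq"
  shows "\<exists>U :: (nat \<Rightarrow> bool) set. |U| =o lam"
proof -
  have "(ctwo ^c natLeq) = |UNIV :: (nat \<Rightarrow> bool) set|"
    by (simp add: cexp_def ctwo_def Field_natLeq Func_def Field_card_of)
  moreover have "|Field lam| =o lam" using assms(1) by (rule card_of_Field_ordIso)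
  ultimately have "|Field lam| \<le>o |UNIV :: (nat \<Rightarrow> bool) set|"
    using assms(2) ordIso_ordLeq_trans by fastforce
  then obtain f :: "_ \<Rightarrow> nat \<Rightarrow> bool" where "inj_on f (Field lam)"
    by (auto simp flip: card_of_ordLeq)
  then have "|f ` Field lam| =o |Field lam|"
    by (rule ordIso_symmetric[OF card_of_ordIsoI[OF inj_on_imp_bij_betw]])
  then show ?thesis using \<open>|Field lam| =o lam\<close> ordIso_transitive by blast
qed

theorem theorem4p1:
  fixes R :: "'r ring" and lam :: "'l rel"
  assumes "ring R" and "\<one>\<^bsub>R\<^esub> \<noteq> \<zero>\<^bsub>R\<^esub>"
    and "is_free_abelian (add_monoid R :: 'r monoid)"
    and "Card_order lam"
    and "|carrier R| <o lam" and "lam \<le>o ctwo ^c natLeq"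
  shows "\<exists>(G :: 'l monoid) (act :: 'l \<Rightarrow> 'r \<Rightarrow> 'l).
    aleph1_free G \<and> |carrier G| =o lam \<and> right_module R G act \<and>
    (\<lambda>r. \<lambda>g\<in>carrier G. act g r) \<in> ring_iso R (End_ring G)"
proof -
  obtain S :: "'r set" and h where "h \<in> iso (add_monoid R) (free_Abelian_group S)"
    using assms(3) by (auto simp: is_free_abelian_def is_iso_def)
  then interpret R: free_ring R S h
    using assms(1,2) by (simp add: free_ring_def free_ring_axioms_def)
  let ?A = "R.\<iota> ` carrier R"
  let ?e = "R.\<iota> \<one>\<^bsub>R\<^esub>"
  interpret A: coefficient_ring ?A R.mul ?e by (rule R.coefficient_ring)
  obtain U :: "(nat \<Rightarrow> bool) set" where U: "|U| =o lam"
    using ordLeq_continuum_subset[OF assms(4,6)] by blast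
  have AU: "|?A| <o |U|"
    using ordIso_ordLess_trans[OF R.card_\<iota> ordLess_ordIso_trans[OF assms(5) ordIso_symmetric[OF U]]] .
  obtain Y lab where "branch_module ?A R.mul ?e Y lab"
    and large: "\<And>b. b \<in> A.AP \<Longrightarrow> |?A| <o |{y \<in> Y. lab y = b}|"
    and Y: "|Y| \<le>o |U|" "|U| \<le>o |Y|"
    using A.exists_branch_module[OF AU] by blast
  then interpret M: branch_module ?A R.mul ?e Y lab by simp
  have "|M.G| =o |U|" using ordLess_imp_ordLeq[OF AU] Y by (rule M.card_G)
  then have "|M.G| =o |Field lam|"
    by (rule ordIso_transitive[OF _ ordIso_transitive[OF U ordIso_symmetric[OF card_of_Field_ordIso[OF assms(4)]]]])
  then obtain \<sigma> where \<sigma>: "bij_betw \<sigma> M.G (Field lam)"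
    using card_of_ordIso by blast
  interpret tr: transported_group M.G \<sigma> "Field lam"
    using M.G_sub \<sigma> by unfold_locales
  define act where "act g r = \<sigma> (M.act (tr.\<tau> g) (R.\<iota> r))" for g r
  have act_in: "M.act (tr.\<tau> g) (R.\<iota> r) \<in> M.G" if "g \<in> Field lam" "r \<in> carrier R" for g r
    using that by (intro M.act_in) auto
  have act_C: "act g r \<in> Field lam" if "g \<in> Field lam" "r \<in> carrier R" for g r
    unfolding act_def using that act_in by simp
  have act_mult: "act (\<sigma> (tr.\<tau> g + tr.\<tau> k)) r = \<sigma> (tr.\<tau> (act g r) + tr.\<tau> (act k r))"
    if "g \<in> Field lam" "k \<in> Field lam" "r \<in> carrier R" for g k r
    using that act_in by (simp add: act_def linear_add[OF M.linear_act_left])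
  have act_add: "act g (r \<oplus>\<^bsub>R\<^esub> s) = \<sigma> (tr.\<tau> (act g r) + tr.\<tau> (act g s))"
    if "g \<in> Field lam" "r \<in> carrier R" "s \<in> carrier R" for g r s
    using that act_in by (simp add: act_def R.\<iota>_add linear_add[OF M.linear_act_right])
  have act_times: "act g (r \<otimes>\<^bsub>R\<^esub> s) = act (act g r) s"
    if "g \<in> Field lam" "r \<in> carrier R" "s \<in> carrier R" for g r s
    using that act_in by (simp add: act_def M.act_act flip: R.mul_\<iota>)
  have act_one: "act g \<one>\<^bsub>R\<^esub> = g" if "g \<in> Field lam" for g
    using that by (simp add: act_def M.act_e)
  have module: "right_module R tr.Gl act"
    using assms(1) tr.comm_group_Gl
    by (intro right_module.intro right_module_axioms.intro)
      (simp_all add: act_C act_mult act_add act_times act_one)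
  let ?F = "\<lambda>r. \<lambda>g\<in>carrier tr.Gl. act g r"
  have hom: "?F \<in> ring_hom R (End_ring tr.Gl)"
    by (rule ring_hom_memI)
      (auto simp: End_ring_def hom_def compose_def act_C act_mult act_add act_times act_one intro!: restrict_ext)
  have "bij_betw ?F (carrier R) (carrier (End_ring tr.Gl))"
  proof (rule bij_betw_imageI)
    show "inj_on ?F (carrier R)"
    proof (rule inj_onI)
      fix r s assume rs: "r \<in> carrier R" "s \<in> carrier R" "?F r = ?F s"
      let ?x = "(sg [] ?e, 0) :: 'r vec"
      have x: "?x \<in> M.G" by simp
      have "act (\<sigma> ?x) r = act (\<sigma> ?x) s"
        using fun_cong[OF rs(3), of "\<sigma> ?x"] x by simp
      then have "M.act ?x (R.\<iota> r) = M.act ?x (R.\<iota> s)"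
        using act_in[of "\<sigma> ?x"] rs x \<sigma> by (auto simp: act_def bij_betw_def dest: inj_onD)
      then have "lk (fst (M.act ?x (R.\<iota> r))) [] = lk (fst (M.act ?x (R.\<iota> s))) []" by simp
      then have "R.\<iota> r = R.\<iota> s"
        using rs(1,2) by (simp add: M.act_def A.rm_single A.mul_e_left)
      then show "r = s" using R.\<iota>_inj rs by (auto dest: inj_onD)
    qed
    show "?F ` carrier R = carrier (End_ring tr.Gl)"
    proof
      show "?F ` carrier R \<subseteq> carrier (End_ring tr.Gl)"
        using ring_hom_closed[OF hom] by blast
      show "carrier (End_ring tr.Gl) \<subseteq> ?F ` carrier R"
      proof
        fix f assume "f \<in> carrier (End_ring tr.Gl)"
        then have f: "f \<in> hom tr.Gl tr.Gl" "f \<in> extensional (Field lam)" by (simp_all add: End_ring_def)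
        have fC: "f g \<in> Field lam" if "g \<in> Field lam" for g using f(1) that by (auto simp: hom_def)
        interpret E: branch_endomorphism ?A R.mul ?e Y lab "\<lambda>u. tr.\<tau> (f (\<sigma> u))"
        proof
          fix u v assume uv: "u \<in> M.G" "v \<in> M.G"
          show "tr.\<tau> (f (\<sigma> u)) \<in> M.G" using uv fC by simp
          have "f (\<sigma> u \<otimes>\<^bsub>tr.Gl\<^esub> \<sigma> v) = f (\<sigma> u) \<otimes>\<^bsub>tr.Gl\<^esub> f (\<sigma> v)"
            using f(1) uv by (intro hom_mult) simp_all
          then show "tr.\<tau> (f (\<sigma> (u + v))) = tr.\<tau> (f (\<sigma> u)) + tr.\<tau> (f (\<sigma> v))"
            using uv fC by simp
        qed
        obtain r where r: "r \<in> carrier R" "\<forall>u\<in>M.G. tr.\<tau> (f (\<sigma> u)) = M.act u (R.\<iota> r)"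
          using E.endomorphism_is_scalar[OF large] by blast
        have "f g = act g r" if g: "g \<in> Field lam" for g
          using r(2)[rule_format, of "tr.\<tau> g"] g fC[OF g] by (simp add: act_def) (metis tr.\<sigma>_\<tau>)
        then have "f = ?F r"
          using f(2) by (intro extensionalityI[where A = "Field lam"]) auto
        then show "f \<in> ?F ` carrier R" using r(1) by blast
      qed
    qed
  qed
  with hom have "?F \<in> ring_iso R (End_ring tr.Gl)" by (simp add: ring_iso_def)
  moreover have "aleph1_free tr.Gl" using \<sigma> by (rule M.transported_aleph1_free)
  moreover have "|carrier tr.Gl| =o lam" using card_of_Field_ordIso[OF assms(4)] by simp
  ultimately show ?thesis using module by blast
qed

end
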